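(* Let $R$ be a standard graded Noetherian ring with $R_0$ a field, and let $I$ be a non-zero proper graded ideal of $R$. Assume that $I$ has no embedded primes, i.e. $\operatorname{Ass}(R/I)=\operatorname{Min}(I)$, and that $\operatorname{ht}(I)\ge 1$. Let $t\ge 1$, let $N_t=I^{(t)}/I^{(t+1)}$, and let $P$ be a minimal prime of $I$. Assume that at least one of the following conditions holds: (1) $\operatorname{depth}(\operatorname{gr}_{IR_P}(R_P))\ge 1$, where $\operatorname{gr}_{IR_P}(R_P)=\bigoplus_{k\ge0} I^kR_P/I^{k+1}R_P$ is the associated graded ring of $IR_P$; (2) $R$ is a polynomial ring (over a field, standard graded) and $I$ is a monomial ideal. Then $$\operatorname{v}_P(N_t)=\operatorname{v}_P(I^{(t+1)}).$$
   Context: For an ideal $I$ of a Noetherian ring $R$ and $t\ge 1$, the $t$-th symbolic power is $I^{(t)}=\left(\bigcap_{P\in \operatorname{Ass}(R/I)} I^tR_P\right)\cap R$, i.e. the set of $r\in R$ whose image in $R_P$ lies in $I^tR_P$ for every $P\in\operatorname{Ass}(R/I)$. $\operatorname{Min}(I)$ is the set of minimal primes of $I$. For a finitely generated graded $R$-module $M$ and $P\in\operatorname{Ass}(M)$, the local v-number of $M$ at $P$ is $\operatorname{v}_P(M)=\min\{\deg m\mid m\in M \text{ homogeneous},\ \operatorname{ann}_R(m)=P\}$. For a graded ideal $J$, $\operatorname{v}_P(J)$ means $\operatorname{v}_P(R/J)$, i.e. $\min\{\deg f\mid f\in R\text{ homogeneous},\ J:f=P\}$. The depth of $\operatorname{gr}_{IR_P}(R_P)$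 is taken with respect to its unique homogeneous maximal ideal $PR_P/IR_P\oplus\bigoplus_{k\ge1} I^kR_P/I^{k+1}R_P$. *)

theory Defs
  imports "HOL-Algebra.Algebra" "HOL-Algebra.Indexed_Polynomials" "HOL-Library.Extended_Nat"
begin

section \<open>Graded rings and graded ideals\<close>

definition homog_decomp ::
    "('a, 'm) ring_scheme \<Rightarrow> (nat \<Rightarrow> 'a set) \<Rightarrow> 'a \<Rightarrow> (nat \<Rightarrow> 'a) \<Rightarrow> bool" where
  "homog_decomp R G x f \<longleftrightarrow>
     (\<forall>n. f n \<in> G n) \<and> finite {n. f n \<noteq> \<zero>\<^bsub>R\<^esub>} \<and> x = finsum R f {n. f n \<noteq> \<zero>\<^bsub>R\<^esub>}"

text \<open>\<open>G n\<close> is the homogeneous component of degree \<open>n\<close>; the fourth assumption says that \<open>R\<close> is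
  the internal direct sum of the \<open>G n\<close>.\<close>

locale standard_graded_ring = cring R for R (structure) +
  fixes G :: "nat \<Rightarrow> 'a set"
  assumes component_subgroup: "additive_subgroup (G n) R"
    and one_degree_0: "\<one> \<in> G 0"
    and component_mult: "\<lbrakk>x \<in> G i; y \<in> G j\<rbrakk> \<Longrightarrow> x \<otimes> y \<in> G (i + j)"
    and direct_sum: "x \<in> carrier R \<Longrightarrow> \<exists>!f. homog_decomp R G x f"
    and generated_degree_1: "generate_ring R (G 0 \<union> G 1) = carrier R"

definition graded_ideal :: "('a, 'm) ring_scheme \<Rightarrow> (nat \<Rightarrow> 'a set) \<Rightarrow> 'a set \<Rightarrow> bool" where
  "graded_ideal R G I \<longleftrightarrow>
     ideal I R \<and> (\<forall>x\<in>I. \<forall>f. homog_decomp R G x f \<longrightarrow> (\<forall>n. f n \<in> I))"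

abbreviation ideal_pow :: "('a, 'm) ring_scheme \<Rightarrow> 'a set \<Rightarrow> nat \<Rightarrow> 'a set" where
  "ideal_pow R I n \<equiv> I [^]\<^bsub>ideals_set R\<^esub> n"

section \<open>Minimal primes and height\<close>

definition minimal_primes :: "('a, 'm) ring_scheme \<Rightarrow> 'a set \<Rightarrow> 'a set set" where
  "minimal_primes R I = {P. primeideal P R \<and> I \<subseteq> P \<and>
     (\<forall>Q. primeideal Q R \<and> I \<subseteq> Q \<and> Q \<subseteq> P \<longrightarrow> Q = P)}"

definition prime_height :: "('a, 'm) ring_scheme \<Rightarrow> 'a set \<Rightarrow> enat" where
  "prime_height R P = Sup {enat n | n. \<exists>Q. (\<forall>i\<le>n. primeideal (Q i) R) \<and>
     (\<forall>i<n. Q i \<subset> Q (Suc i)) \<and> Q n = P}"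

definition ideal_height :: "('a, 'm) ring_scheme \<Rightarrow> 'a set \<Rightarrow> enat" where
  "ideal_height R I = (INF P\<in>{P. primeideal P R \<and> I \<subseteq> P}. prime_height R P)"

section \<open>Subquotient modules, associated primes, v-numbers\<close>

definition annihilator ::
    "('a, 'm) ring_scheme \<Rightarrow> ('a, 'b, 'n) module_scheme \<Rightarrow> 'b \<Rightarrow> 'a set" where
  "annihilator R M m = {r \<in> carrier R. r \<odot>\<^bsub>M\<^esub> m = \<zero>\<^bsub>M\<^esub>}"

definition assoc_primes ::
    "('a, 'm) ring_scheme \<Rightarrow> ('a, 'b, 'n) module_scheme \<Rightarrow> 'a set set" where
  "assoc_primes R M = {P. primeideal P R \<and> (\<exists>m\<in>carrier M. annihilator R M m = P)}"

text \<open>The \<open>R\<close>-module \<open>K/L\<close> for ideals \<open>L \<subseteq> K\<close>. Module records carry a multiplication and a unit,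
  which play no role here; they are filled in as in \<open>R Quot L\<close>.\<close>

definition subquotient ::
    "('a, 'm) ring_scheme \<Rightarrow> 'a set \<Rightarrow> 'a set \<Rightarrow> ('a, 'a set) module" where
  "subquotient R K L =
    \<lparr>carrier = (\<lambda>x. L +>\<^bsub>R\<^esub> x) ` K, monoid.mult = rcoset_mult R L,
     one = L +>\<^bsub>R\<^esub> \<one>\<^bsub>R\<^esub>, ring.zero = L, add = set_add R,
     smult = (\<lambda>r. rcoset_mult R L (L +>\<^bsub>R\<^esub> r))\<rparr>"

definition subquotient_component ::
    "('a, 'm) ring_scheme \<Rightarrow> (nat \<Rightarrow> 'a set) \<Rightarrow> 'a set \<Rightarrow> 'a set \<Rightarrow> nat \<Rightarrow> 'a set set" where
  "subquotient_component R G K L d = (\<lambda>x. L +>\<^bsub>R\<^esub> x) ` (K \<inter> G d)"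

abbreviation quotient_module :: "('a, 'm) ring_scheme \<Rightarrow> 'a set \<Rightarrow> ('a, 'a set) module" where
  "quotient_module R J \<equiv> subquotient R (carrier R) J"

text \<open>\<open>D d\<close> is the degree-\<open>d\<close> component of \<open>M\<close>. As \<open>P\<close> is a proper ideal, an element with
  annihilator \<open>P\<close> is non-zero, so its degree is unambiguous. The value is \<open>\<infinity>\<close> if there is
  no homogeneous element with annihilator \<open>P\<close>, and the minimum otherwise.\<close>

definition local_v_number ::
    "('a, 'm) ring_scheme \<Rightarrow> ('a, 'b, 'n) module_scheme \<Rightarrow> (nat \<Rightarrow> 'b set) \<Rightarrow> 'a set \<Rightarrow> enat" where
  "local_v_number R M D P = Inf {enat d | d. \<exists>m\<in>D d. annihilator R M m = P}"

definition v_subquotient ::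
    "('a, 'm) ring_scheme \<Rightarrow> (nat \<Rightarrow> 'a set) \<Rightarrow> 'a set \<Rightarrow> 'a set \<Rightarrow> 'a set \<Rightarrow> enat" where
  "v_subquotient R G K L P =
     local_v_number R (subquotient R K L) (subquotient_component R G K L) P"

definition v_ideal ::
    "('a, 'm) ring_scheme \<Rightarrow> (nat \<Rightarrow> 'a set) \<Rightarrow> 'a set \<Rightarrow> 'a set \<Rightarrow> enat" where
  "v_ideal R G J P = v_subquotient R G (carrier R) J P"

section \<open>Localization and symbolic powers\<close>

text \<open>For \<open>S\<close> multiplicatively closed with \<open>\<one> \<in> S\<close>: the class of the fraction \<open>a/s\<close>, as a set of pairs (numerator, denominator). Sums and
  products of classes are unions over all representatives, in the style of \<^const>\<open>rcoset_mult\<close>.\<close>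

definition fraction ::
    "('a, 'm) ring_scheme \<Rightarrow> 'a set \<Rightarrow> 'a \<Rightarrow> 'a \<Rightarrow> ('a \<times> 'a) set" where
  "fraction R S a s = {(b, u). b \<in> carrier R \<and> u \<in> S \<and>
     (\<exists>w\<in>S. w \<otimes>\<^bsub>R\<^esub> (u \<otimes>\<^bsub>R\<^esub> a) = w \<otimes>\<^bsub>R\<^esub> (s \<otimes>\<^bsub>R\<^esub> b))}"

definition localization :: "('a, 'm) ring_scheme \<Rightarrow> 'a set \<Rightarrow> ('a \<times> 'a) set ring" where
  "localization R S =
    \<lparr>carrier = {fraction R S a s | a s. a \<in> carrier R \<and> s \<in> S},
     monoid.mult = (\<lambda>U W. \<Union>p\<in>U. \<Union>q\<in>W.
       fraction R S (fst p \<otimes>\<^bsub>R\<^esub> fst q) (snd p \<otimes>\<^bsub>R\<^esub> snd q)),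
     one = fraction R S \<one>\<^bsub>R\<^esub> \<one>\<^bsub>R\<^esub>,
     ring.zero = fraction R S \<zero>\<^bsub>R\<^esub> \<one>\<^bsub>R\<^esub>,
     add = (\<lambda>U W. \<Union>p\<in>U. \<Union>q\<in>W.
       fraction R S ((snd q \<otimes>\<^bsub>R\<^esub> fst p) \<oplus>\<^bsub>R\<^esub> (snd p \<otimes>\<^bsub>R\<^esub> fst q)) (snd p \<otimes>\<^bsub>R\<^esub> snd q))\<rparr>"

definition local_ring_at :: "('a, 'm) ring_scheme \<Rightarrow> 'a set \<Rightarrow> ('a \<times> 'a) set ring" where
  "local_ring_at R P = localization R (carrier R - P)"

definition local_map :: "('a, 'm) ring_scheme \<Rightarrow> 'a set \<Rightarrow> 'a \<Rightarrow> ('a \<times> 'a) set" where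
  "local_map R P r = fraction R (carrier R - P) r \<one>\<^bsub>R\<^esub>"

text \<open>The extended ideal \<open>J R\<^sub>P\<close>.\<close>

definition local_ext :: "('a, 'm) ring_scheme \<Rightarrow> 'a set \<Rightarrow> 'a set \<Rightarrow> ('a \<times> 'a) set set" where
  "local_ext R P J = genideal (local_ring_at R P) (local_map R P ` J)"

definition symbolic_power :: "('a, 'm) ring_scheme \<Rightarrow> 'a set \<Rightarrow> nat \<Rightarrow> 'a set" where
  "symbolic_power R I t = {r \<in> carrier R.
     \<forall>P\<in>assoc_primes R (quotient_module R I). local_map R P r \<in> local_ext R P (ideal_pow R I t)}"

section \<open>Associated graded ring and depth\<close>

text \<open>Elements of the direct sum of the \<open>J\<^sup>k/J\<^sup>k\<^sup>+\<^sup>1\<close> are sequences of cosets, almost all of them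
  zero. The product of a coset in degree \<open>i\<close> and one in degree \<open>k - i\<close> is formed modulo
  \<open>J\<^sup>k\<^sup>+\<^sup>1\<close>.\<close>

definition assoc_graded_ring :: "('a, 'm) ring_scheme \<Rightarrow> 'a set \<Rightarrow> (nat \<Rightarrow> 'a set) ring" where
  "assoc_graded_ring A J =
    \<lparr>carrier = {f. (\<forall>k. f k \<in> (\<lambda>x. ideal_pow A J (Suc k) +>\<^bsub>A\<^esub> x) ` ideal_pow A J k) \<and>
                   finite {k. f k \<noteq> ideal_pow A J (Suc k)}},
     monoid.mult = (\<lambda>f g k. finsum (A Quot ideal_pow A J (Suc k))
               (\<lambda>i. rcoset_mult A (ideal_pow A J (Suc k)) (f i) (g (k - i))) {..k}),
     one = (\<lambda>k. ideal_pow A J (Suc k) +>\<^bsub>A\<^esub> (if k = 0 then \<one>\<^bsub>A\<^esub> else \<zero>\<^bsub>A\<^esub>)),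
     ring.zero = (\<lambda>k. ideal_pow A J (Suc k)),
     add = (\<lambda>f g k. f k <+>\<^bsub>A\<^esub> g k)\<rparr>"

text \<open>For a local ring \<open>A\<close> with maximal ideal \<open>m\<close> containing \<open>J\<close>: the homogeneous maximal ideal,
  consisting of \<open>m/J\<close> in degree \<open>0\<close> and everything in positive degrees.\<close>

definition assoc_graded_max_ideal ::
    "('a, 'm) ring_scheme \<Rightarrow> 'a set \<Rightarrow> 'a set \<Rightarrow> (nat \<Rightarrow> 'a set) set" where
  "assoc_graded_max_ideal A J m =
     {f \<in> carrier (assoc_graded_ring A J). f 0 \<in> (\<lambda>x. J +>\<^bsub>A\<^esub> x) ` m}"

definition regular_sequence :: "('a, 'm) ring_scheme \<Rightarrow> 'a list \<Rightarrow> bool" where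
  "regular_sequence A xs \<longleftrightarrow> set xs \<subseteq> carrier A \<and>
     (\<forall>i<length xs. \<forall>a\<in>carrier A.
        xs ! i \<otimes>\<^bsub>A\<^esub> a \<in> genideal A (set (take i xs)) \<longrightarrow> a \<in> genideal A (set (take i xs))) \<and>
     genideal A (set xs) \<noteq> carrier A"

definition depth :: "('a, 'm) ring_scheme \<Rightarrow> 'a set \<Rightarrow> enat" where
  "depth A m = (SUP xs\<in>{xs. regular_sequence A xs \<and> set xs \<subseteq> m}. enat (length xs))"

text \<open>The depth of the associated graded ring of \<open>I R\<^sub>P\<close> with respect to its homogeneous
  maximal ideal.\<close>

definition depth_gr_local :: "('a, 'm) ring_scheme \<Rightarrow> 'a set \<Rightarrow> 'a set \<Rightarrow> enat" where
  "depth_gr_local R I P =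
     depth (assoc_graded_ring (local_ring_at R P) (local_ext R P I))
       (assoc_graded_max_ideal (local_ring_at R P) (local_ext R P I) (local_ext R P P))"

section \<open>Polynomial rings and monomial ideals\<close>

definition monomial :: "('a, 'm) ring_scheme \<Rightarrow> 'a multiset \<Rightarrow> 'a" where
  "monomial R m = finprod R (\<lambda>x. x [^]\<^bsub>R\<^esub> count m x) (set_mset m)"

text \<open>\<open>R = K[V]\<close> for a subring \<open>K\<close> and a subset \<open>V\<close> of \<open>R\<close>: evaluation identifies the indexed
  polynomials with coefficients in \<open>K\<close> and variables indexed by \<open>V\<close> itself (finitely supported
  families of coefficients, indexed by multisets on \<open>V\<close>) with \<open>R\<close>.\<close>

definition is_polynomial_ring :: "('a, 'm) ring_scheme \<Rightarrow> 'a set \<Rightarrow> 'a set \<Rightarrow> bool" where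
  "is_polynomial_ring R K V \<longleftrightarrow> V \<subseteq> carrier R \<and>
     bij_betw (\<lambda>c. finsum R (\<lambda>m. c m \<otimes>\<^bsub>R\<^esub> monomial R m) {m. c m \<noteq> \<zero>\<^bsub>R\<^esub>})
       (ring.indexed_pset R V K) (carrier R)"

definition monomial_ideal :: "('a, 'm) ring_scheme \<Rightarrow> 'a set \<Rightarrow> 'a set \<Rightarrow> bool" where
  "monomial_ideal R V I \<longleftrightarrow> (\<exists>S \<subseteq> {monomial R m | m. set_mset m \<subseteq> V}. I = genideal R S)"

end

theory Submission
  imports Defs
begin

text \<open>Let \<open>f\<close> satisfy \<open>I\<^sup>(\<^sup>t\<^sup>+\<^sup>1\<^sup>) : f = P\<close>. Then \<open>f\<close> lies in \<open>I\<^sup>(\<^sup>t\<^sup>)\<close> automatically, so both v-numbers are minima over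
  the same set. At a minimal prime \<open>Q \<noteq> P\<close> some element of \<open>P\<close> becomes a unit, hence \<open>f \<in> I\<^sup>t\<^sup>+\<^sup>1 R\<^sub>Q\<close>.
  At \<open>P\<close> one has \<open>P f \<subseteq> I\<^sup>t\<^sup>+\<^sup>1 R\<^sub>P\<close>. If \<open>f\<close> were not in \<open>I\<^sup>t R\<^sub>P\<close>, its initial form would be killed by the
  homogeneous maximal ideal of the associated graded ring, contradicting positive depth. In the
  monomial case \<open>P\<close> contains a variable \<open>x\<close>, and \<open>x g \<in> I\<^sup>t\<^sup>+\<^sup>1\<close> implies \<open>g \<in> I\<^sup>t\<close>: in a product of \<open>t + 1\<close>
  monomials of \<open>I\<close>, dividing by \<open>x\<close> spoils at most one factor.\<close>

section \<open>Powers of ideals\<close>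

lemma ideals_set_simps [simp]:
  "\<one>\<^bsub>ideals_set R\<^esub> = carrier R" "I \<otimes>\<^bsub>ideals_set R\<^esub> J = I \<cdot>\<^bsub>R\<^esub> J"
  by (simp_all add: ideals_set_def)

lemma ideal_pow_simps [simp]:
  "ideal_pow R I 0 = carrier R" "ideal_pow R I (Suc n) = ideal_pow R I n \<cdot>\<^bsub>R\<^esub> I"
  by (simp_all add: nat_pow_def)

context ring
begin

lemma ideal_pow_ideal: "ideal I R \<Longrightarrow> ideal (ideal_pow R I n) R"
  by (induction n) (auto intro: oneideal ideal_prod_is_ideal)

lemma ideal_pow_Suc_subset: "ideal I R \<Longrightarrow> ideal_pow R I (Suc n) \<subseteq> ideal_pow R I n"
  using ideal_prod_inter[of "ideal_pow R I n" I] by (simp add: ideal_pow_ideal)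

lemma ideal_pow_antimono: "ideal I R \<Longrightarrow> m \<le> n \<Longrightarrow> ideal_pow R I n \<subseteq> ideal_pow R I m"
  by (rule lift_Suc_antimono_le[of "ideal_pow R I"]) (rule ideal_pow_Suc_subset)

lemma ideal_pow_mult:
  assumes I: "ideal I R" and x: "x \<in> ideal_pow R I i"
  shows "y \<in> ideal_pow R I j \<Longrightarrow> x \<otimes> y \<in> ideal_pow R I (i + j)"
proof (induction j arbitrary: y)
  case 0
  then show ?case using x ideal.I_r_closed[OF ideal_pow_ideal[OF I]] by auto
next
  case (Suc j)
  have "y \<in> ideal_pow R I j \<cdot> I" using Suc.prems by simp
  then show ?case
  proof (induction rule: ideal_prod.induct)
    case (prod y z)
    have "x \<in> carrier R" "y \<in> carrier R" "z \<in> carrier R"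
      using x prod ideal.Icarr[OF ideal_pow_ideal[OF I]] ideal.Icarr[OF I] by blast+
    moreover have "(x \<otimes> y) \<otimes> z \<in> ideal_pow R I (i + j) \<cdot> I"
      using Suc.IH prod by (blast intro: ideal_prod.prod)
    ultimately show ?case by (simp add: m_assoc)
  next
    case (sum y z)
    have "x \<in> carrier R" using x ideal.Icarr[OF ideal_pow_ideal[OF I]] by blast
    moreover have "y \<in> carrier R" "z \<in> carrier R"
      using sum.hyps ideal_prod_in_carrier[OF ideal_pow_ideal[OF I] I] by blast+
    moreover have "x \<otimes> y \<oplus> x \<otimes> z \<in> ideal_pow R I (i + Suc j)"
      using sum.IH by (simp add: ideal_prod.sum)
    ultimately show ?case by (simp add: r_distr)
  qed
qed

end

section \<open>Localization\<close>

locale cring_localization = cring R + S: submonoid S R for R (structure) and S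
begin

text \<open>This is transitivity of the relation between fractions. Since \<open>S\<close> may
  contain zero divisors, the relation carries a multiplier, and the multipliers of both given
  relations must be combined.\<close>

lemma fraction_subset:
  assumes "a \<in> carrier R" "b \<in> carrier R" "s \<in> S" "u \<in> S" "w \<in> S"
    and eq: "w \<otimes> (u \<otimes> a) = w \<otimes> (s \<otimes> b)"
  shows "fraction R S a s \<subseteq> fraction R S b u"
proof
  fix p assume "p \<in> fraction R S a s"
  then obtain c v x where p: "p = (c, v)" "c \<in> carrier R" "v \<in> S" "x \<in> S"
    and eq': "x \<otimes> (v \<otimes> a) = x \<otimes> (s \<otimes> c)"
    unfolding fraction_def by auto
  note [simp] = assms(1-5) p
  \<comment> \<open>The multiplier collects \<open>x\<close> and \<open>w\<close> from the two
    relations and the denominator \<open>s\<close> of the fraction through which they are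
    linked.\<close>
  have "(x \<otimes> w \<otimes> s) \<otimes> (v \<otimes> b) = x \<otimes> v \<otimes> (w \<otimes> (s \<otimes> b))" by (simp add: m_ac)
  also have "\<dots> = w \<otimes> u \<otimes> (x \<otimes> (v \<otimes> a))" unfolding eq[symmetric] by (simp add: m_ac)
  also have "\<dots> = (x \<otimes> w \<otimes> s) \<otimes> (u \<otimes> c)" unfolding eq' by (simp add: m_ac)
  finally have "(x \<otimes> w \<otimes> s) \<otimes> (v \<otimes> b) = (x \<otimes> w \<otimes> s) \<otimes> (u \<otimes> c)" .
  moreover have "x \<otimes> w \<otimes> s \<in> S" by simp
  ultimately show "p \<in> fraction R S b u"
    unfolding fraction_def using p by auto
qed

lemma fraction_eqI:
  assumes "a \<in> carrier R" "b \<in> carrier R" "s \<in> S" "u \<in> S" "w \<in> S"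
    and "w \<otimes> (u \<otimes> a) = w \<otimes> (s \<otimes> b)"
  shows "fraction R S a s = fraction R S b u"
  using fraction_subset[of a b s u w] fraction_subset[of b a u s w] assms by auto

lemma fraction_self: "a \<in> carrier R \<Longrightarrow> s \<in> S \<Longrightarrow> (a, s) \<in> fraction R S a s"
  unfolding fraction_def by auto

lemma mem_fraction:
  assumes p: "p \<in> fraction R S a s" and a: "a \<in> carrier R" "s \<in> S"
  shows "fst p \<in> carrier R" "snd p \<in> S" "fraction R S (fst p) (snd p) = fraction R S a s"
proof -
  obtain w where w: "fst p \<in> carrier R" "snd p \<in> S" "w \<in> S"
      "w \<otimes> (snd p \<otimes> a) = w \<otimes> (s \<otimes> fst p)"
    using p unfolding fraction_def by auto
  show "fst p \<in> carrier R" "snd p \<in> S" by fact+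
  show "fraction R S (fst p) (snd p) = fraction R S a s"
    by (rule fraction_eqI[symmetric, OF a(1) w(1) a(2) w(2-4)])
qed

lemma fraction_eqE:
  assumes "fraction R S a s = fraction R S b u" "b \<in> carrier R" "u \<in> S"
  obtains w where "w \<in> S" "w \<otimes> (u \<otimes> a) = w \<otimes> (s \<otimes> b)"
proof -
  have "(b, u) \<in> fraction R S a s" using assms fraction_self by simp
  then show thesis using that unfolding fraction_def by auto
qed

text \<open>The product in \<open>localization\<close> is a union over all pairs of representatives.
  All classes in this union coincide, and it is not empty, so it collapses to the class of any one
  pair; \<open>fraction_add\<close> rests on the same principle.\<close>

lemma fraction_mult:
  assumes "a \<in> carrier R" "b \<in> carrier R" "s \<in> S" "u \<in> S"
  shows "fraction R S a s \<otimes>\<^bsub>localization R S\<^esub> fraction R S b u = fraction R S (a \<otimes> b) (s \<otimes> u)"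
proof -
  have eq: "fraction R S (fst p \<otimes> fst q) (snd p \<otimes> snd q) = fraction R S (a \<otimes> b) (s \<otimes> u)"
    if p: "p \<in> fraction R S a s" and q: "q \<in> fraction R S b u" for p q
  proof -
    obtain w where w: "w \<in> S" "w \<otimes> (s \<otimes> fst p) = w \<otimes> (snd p \<otimes> a)"
      by (rule fraction_eqE[OF mem_fraction(3)[OF p assms(1,3)] assms(1,3)])
    obtain x where x: "x \<in> S" "x \<otimes> (u \<otimes> fst q) = x \<otimes> (snd q \<otimes> b)"
      by (rule fraction_eqE[OF mem_fraction(3)[OF q assms(2,4)] assms(2,4)])
    note [simp] = assms w(1) x(1) mem_fraction(1,2)[OF p] mem_fraction(1,2)[OF q]
    have "(w \<otimes> x) \<otimes> ((s \<otimes> u) \<otimes> (fst p \<otimes> fst q)) = (w \<otimes> (s \<otimes> fst p)) \<otimes> (x \<otimes> (u \<otimes> fst q))"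
      by (simp add: m_ac)
    also have "\<dots> = (w \<otimes> x) \<otimes> ((snd p \<otimes> snd q) \<otimes> (a \<otimes> b))"
      unfolding w(2) x(2) by (simp add: m_ac)
    finally show ?thesis by (intro fraction_eqI[where w = "w \<otimes> x"]) auto
  qed
  have "fraction R S a s \<noteq> {}" "fraction R S b u \<noteq> {}"
    using fraction_self assms by blast+
  then show ?thesis unfolding localization_def by (simp add: eq)
qed

lemma fraction_add:
  assumes "a \<in> carrier R" "b \<in> carrier R" "s \<in> S" "u \<in> S"
  shows "fraction R S a s \<oplus>\<^bsub>localization R S\<^esub> fraction R S b u =
    fraction R S (u \<otimes> a \<oplus> s \<otimes> b) (s \<otimes> u)"
proof -
  have eq: "fraction R S (snd q \<otimes> fst p \<oplus> snd p \<otimes> fst q) (snd p \<otimes> snd q) =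
      fraction R S (u \<otimes> a \<oplus> s \<otimes> b) (s \<otimes> u)"
    if p: "p \<in> fraction R S a s" and q: "q \<in> fraction R S b u" for p q
  proof -
    obtain w where w: "w \<in> S" "w \<otimes> (s \<otimes> fst p) = w \<otimes> (snd p \<otimes> a)"
      by (rule fraction_eqE[OF mem_fraction(3)[OF p assms(1,3)] assms(1,3)])
    obtain x where x: "x \<in> S" "x \<otimes> (u \<otimes> fst q) = x \<otimes> (snd q \<otimes> b)"
      by (rule fraction_eqE[OF mem_fraction(3)[OF q assms(2,4)] assms(2,4)])
    note [simp] = assms w(1) x(1) mem_fraction(1,2)[OF p] mem_fraction(1,2)[OF q]
    have "(w \<otimes> x) \<otimes> ((s \<otimes> u) \<otimes> (snd q \<otimes> fst p \<oplus> snd p \<otimes> fst q)) =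
        (x \<otimes> u \<otimes> snd q) \<otimes> (w \<otimes> (s \<otimes> fst p)) \<oplus> (w \<otimes> s \<otimes> snd p) \<otimes> (x \<otimes> (u \<otimes> fst q))"
      by (simp add: m_ac r_distr)
    also have "\<dots> = (w \<otimes> x) \<otimes> ((snd p \<otimes> snd q) \<otimes> (u \<otimes> a \<oplus> s \<otimes> b))"
      unfolding w(2) x(2) by (simp add: m_ac r_distr)
    finally show ?thesis by (intro fraction_eqI[where w = "w \<otimes> x"]) auto
  qed
  have "fraction R S a s \<noteq> {}" "fraction R S b u \<noteq> {}"
    using fraction_self assms by blast+
  then show ?thesis unfolding localization_def by (simp add: eq)
qed

lemma carrier_localization:
  "carrier (localization R S) = {fraction R S a s | a s. a \<in> carrier R \<and> s \<in> S}"
  "\<one>\<^bsub>localization R S\<^esub> = fraction R S \<one> \<one>"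
  "\<zero>\<^bsub>localization R S\<^esub> = fraction R S \<zero> \<one>"
  by (simp_all add: localization_def)

lemma fraction_closed [simp]:
  "a \<in> carrier R \<Longrightarrow> s \<in> S \<Longrightarrow> fraction R S a s \<in> carrier (localization R S)"
  by (auto simp: carrier_localization)

lemma fraction_zero: "s \<in> S \<Longrightarrow> fraction R S \<zero> s = \<zero>\<^bsub>localization R S\<^esub>"
  unfolding carrier_localization(3) by (rule fraction_eqI[where w = \<one>]) simp_all

lemma fraction_cancel:
  "a \<in> carrier R \<Longrightarrow> s \<in> S \<Longrightarrow> u \<in> S \<Longrightarrow> fraction R S (u \<otimes> a) (u \<otimes> s) = fraction R S a s"
  by (rule fraction_eqI[where w = \<one>]) (simp_all add: m_ac)

lemma localizationE:
  assumes "x \<in> carrier (localization R S)"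
  obtains a s where "x = fraction R S a s" "a \<in> carrier R" "s \<in> S"
  using assms unfolding carrier_localization(1) by blast

section \<open>Ring structure of the localization\<close>

lemma localization_cring: "cring (localization R S)"
proof (rule cringI)
  let ?L = "localization R S"
  show "abelian_group ?L"
  proof (rule abelian_groupI)
    show "x \<oplus>\<^bsub>?L\<^esub> y \<in> carrier ?L" if "x \<in> carrier ?L" "y \<in> carrier ?L" for x y
      using that by (elim localizationE) (simp add: fraction_add)
    show "\<zero>\<^bsub>?L\<^esub> \<in> carrier ?L" by (simp add: carrier_localization(3))
    show "x \<oplus>\<^bsub>?L\<^esub> y \<oplus>\<^bsub>?L\<^esub> z = x \<oplus>\<^bsub>?L\<^esub> (y \<oplus>\<^bsub>?L\<^esub> z)"
      if "x \<in> carrier ?L" "y \<in> carrier ?L" "z \<in> carrier ?L" for x y z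
      using that by (elim localizationE) (simp add: fraction_add r_distr m_ac a_ac)
    show "x \<oplus>\<^bsub>?L\<^esub> y = y \<oplus>\<^bsub>?L\<^esub> x" if "x \<in> carrier ?L" "y \<in> carrier ?L" for x y
      using that by (elim localizationE) (simp add: fraction_add m_ac a_ac)
    show "\<zero>\<^bsub>?L\<^esub> \<oplus>\<^bsub>?L\<^esub> x = x" if "x \<in> carrier ?L" for x
      using that by (elim localizationE) (simp add: fraction_add carrier_localization(3))
    show "\<exists>y\<in>carrier ?L. y \<oplus>\<^bsub>?L\<^esub> x = \<zero>\<^bsub>?L\<^esub>" if x: "x \<in> carrier ?L" for x
    proof -
      obtain a s where as: "x = fraction R S a s" "a \<in> carrier R" "s \<in> S"
        using x by (rule localizationE)
      have "fraction R S (\<ominus> a) s \<oplus>\<^bsub>?L\<^esub> x = \<zero>\<^bsub>?L\<^esub>"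
        using as by (simp add: fraction_add r_minus l_neg fraction_zero)
      moreover have "fraction R S (\<ominus> a) s \<in> carrier ?L" using as by simp
      ultimately show ?thesis by blast
    qed
  qed
  show "comm_monoid ?L"
  proof (rule comm_monoidI)
    show "x \<otimes>\<^bsub>?L\<^esub> y \<in> carrier ?L" if "x \<in> carrier ?L" "y \<in> carrier ?L" for x y
      using that by (elim localizationE) (simp add: fraction_mult)
    show "\<one>\<^bsub>?L\<^esub> \<in> carrier ?L" by (simp add: carrier_localization(2))
    show "x \<otimes>\<^bsub>?L\<^esub> y \<otimes>\<^bsub>?L\<^esub> z = x \<otimes>\<^bsub>?L\<^esub> (y \<otimes>\<^bsub>?L\<^esub> z)"
      if "x \<in> carrier ?L" "y \<in> carrier ?L" "z \<in> carrier ?L" for x y z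
      using that by (elim localizationE) (simp add: fraction_mult m_ac)
    show "x \<otimes>\<^bsub>?L\<^esub> y = y \<otimes>\<^bsub>?L\<^esub> x" if "x \<in> carrier ?L" "y \<in> carrier ?L" for x y
      using that by (elim localizationE) (simp add: fraction_mult m_ac)
    show "\<one>\<^bsub>?L\<^esub> \<otimes>\<^bsub>?L\<^esub> x = x" if "x \<in> carrier ?L" for x
      using that by (elim localizationE) (simp add: fraction_mult carrier_localization(2))
  qed
  show "(x \<oplus>\<^bsub>?L\<^esub> y) \<otimes>\<^bsub>?L\<^esub> z = x \<otimes>\<^bsub>?L\<^esub> z \<oplus>\<^bsub>?L\<^esub> y \<otimes>\<^bsub>?L\<^esub> z"
    if xyz: "x \<in> carrier ?L" "y \<in> carrier ?L" "z \<in> carrier ?L" for x y z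
  proof -
    obtain a s where [simp]: "x = fraction R S a s" "a \<in> carrier R" "s \<in> S"
      using xyz(1) by (rule localizationE)
    obtain b u where [simp]: "y = fraction R S b u" "b \<in> carrier R" "u \<in> S"
      using xyz(2) by (rule localizationE)
    obtain c v where [simp]: "z = fraction R S c v" "c \<in> carrier R" "v \<in> S"
      using xyz(3) by (rule localizationE)
    \<comment> \<open>Unlike for the other ring laws, the two sides have different representatives:
      on the right, numerator and denominator carry an additional factor \<open>v\<close>, so
      equality of classes has to be used.\<close>
    show ?thesis
      by (simp add: fraction_add fraction_mult)
        (rule fraction_eqI[where w = \<one>]; simp add: l_distr r_distr m_ac)
  qed
qed

sublocale L: cring "localization R S" by (rule localization_cring)

section \<open>Extended ideals and their powers\<close>

text \<open>For an ideal \<open>J\<close>, common denominators make this set closed under sums, so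
  it is already the ideal generated by the image of \<open>J\<close>
  (\<open>genideal_eq_ext\<close>), with each element displayed as a single fraction.\<close>

definition ext :: "'a set \<Rightarrow> ('a \<times> 'a) set set" where
  "ext J = {fraction R S a s | a s. a \<in> J \<and> s \<in> S}"

lemma extI: "a \<in> J \<Longrightarrow> s \<in> S \<Longrightarrow> fraction R S a s \<in> ext J"
  unfolding ext_def by blast

lemma fraction_minus:
  assumes "a \<in> carrier R" "s \<in> S"
  shows "\<ominus>\<^bsub>localization R S\<^esub> fraction R S a s = fraction R S (\<ominus> a) s"
  by (rule L.minus_equality) (use assms in \<open>simp_all add: fraction_add r_minus l_neg fraction_zero\<close>)

lemma ext_ideal:
  assumes "ideal J R"
  shows "ideal (ext J) (localization R S)"
proof (rule idealI)
  interpret J: ideal J R by fact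
  let ?L = "localization R S"
  show "ring ?L" by (rule L.ring_axioms)
  show "subgroup (ext J) (add_monoid ?L)"
  proof (rule L.add.subgroupI)
    show "ext J \<subseteq> carrier ?L" by (auto simp: ext_def)
    show "ext J \<noteq> {}" unfolding ext_def using J.zero_closed S.one_closed by blast
    show "\<ominus>\<^bsub>?L\<^esub> x \<in> ext J" if "x \<in> ext J" for x
    proof -
      obtain a s where "x = fraction R S a s" "a \<in> J" "s \<in> S"
        using \<open>x \<in> ext J\<close> by (auto simp: ext_def)
      then show ?thesis
        by (simp add: fraction_minus extI J.a_inv_closed)
    qed
    show "x \<oplus>\<^bsub>?L\<^esub> y \<in> ext J" if "x \<in> ext J" "y \<in> ext J" for x y
      using that by (auto simp: ext_def fraction_add)
        (metis J.I_l_closed J.a_closed S.m_closed S.mem_carrier)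
  qed
  have l: "y \<otimes>\<^bsub>?L\<^esub> x \<in> ext J" if "x \<in> ext J" "y \<in> carrier ?L" for x y
    using that by (auto simp: ext_def carrier_localization(1) fraction_mult)
      (metis J.I_l_closed S.m_closed)
  show "y \<otimes>\<^bsub>?L\<^esub> x \<in> ext J" if "x \<in> ext J" "y \<in> carrier ?L" for x y
    using that by (rule l)
  show "x \<otimes>\<^bsub>?L\<^esub> y \<in> ext J" if "x \<in> ext J" "y \<in> carrier ?L" for x y
  proof -
    have "x \<in> carrier ?L" using that(1) by (auto simp: ext_def)
    then show ?thesis using l[OF that] that(2) by (simp add: L.m_comm)
  qed
qed

lemma genideal_eq_ext:
  assumes "ideal J R"
  shows "genideal (localization R S) ((\<lambda>r. fraction R S r \<one>) ` J) = ext J"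
proof
  interpret J: ideal J R by fact
  let ?L = "localization R S" and ?X = "(\<lambda>r. fraction R S r \<one>) ` J"
  show "genideal ?L ?X \<subseteq> ext J"
    by (rule L.genideal_minimal[OF ext_ideal[OF assms]]) (auto intro: extI)
  have "?X \<subseteq> carrier ?L" by auto
  then interpret X: ideal "genideal ?L ?X" ?L by (rule L.genideal_ideal)
  show "ext J \<subseteq> genideal ?L ?X"
  proof
    fix x assume "x \<in> ext J"
    then obtain a s where x: "x = fraction R S a s" "a \<in> J" "s \<in> S"
      by (auto simp: ext_def)
    have "fraction R S a \<one> \<in> genideal ?L ?X"
      using L.genideal_self[OF \<open>?X \<subseteq> carrier ?L\<close>] x by blast
    then have "fraction R S a \<one> \<otimes>\<^bsub>?L\<^esub> fraction R S \<one> s \<in> genideal ?L ?X"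
      using x by (intro X.I_r_closed) auto
    then show "x \<in> genideal ?L ?X" using x by (simp add: fraction_mult)
  qed
qed

text \<open>Clearing denominators turns membership in an extended ideal into a statement inside
  \<open>R\<close>. The numerator \<open>r\<close> itself may lie outside \<open>J\<close>; only
  some multiple by an element of \<open>S\<close> is in \<open>J\<close>.\<close>

lemma fraction_mem_ext_iff:
  assumes "ideal J R" and r: "r \<in> carrier R" "u \<in> S"
  shows "fraction R S r u \<in> ext J \<longleftrightarrow> (\<exists>s\<in>S. s \<otimes> r \<in> J)"
proof
  interpret J: ideal J R by fact
  assume "fraction R S r u \<in> ext J"
  then obtain a s where as: "a \<in> J" "s \<in> S" and eq: "fraction R S r u = fraction R S a s"
    by (auto simp: ext_def)
  obtain w where w: "w \<in> S" "w \<otimes> (s \<otimes> r) = w \<otimes> (u \<otimes> a)"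
    using fraction_eqE[OF eq] as by auto
  have "w \<otimes> u \<otimes> a \<in> J" using w(1) as r by (simp add: J.I_l_closed)
  then have "(w \<otimes> s) \<otimes> r \<in> J" using w as r by (simp add: m_assoc)
  then show "\<exists>s\<in>S. s \<otimes> r \<in> J" using w(1) as by blast
next
  assume "\<exists>s\<in>S. s \<otimes> r \<in> J"
  then obtain s where s: "s \<in> S" "s \<otimes> r \<in> J" by blast
  then have "fraction R S (s \<otimes> r) (s \<otimes> u) \<in> ext J" using r by (auto intro: extI)
  then show "fraction R S r u \<in> ext J" using s r by (simp add: fraction_cancel)
qed

lemma ext_carrier: "ext (carrier R) = carrier (localization R S)"
  by (auto simp: ext_def carrier_localization)

lemma ext_ideal_prod:
  assumes J: "ideal J R" and K: "ideal K R"
  shows "ext (J \<cdot> K) = ext J \<cdot>\<^bsub>localization R S\<^esub> ext K"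
proof
  interpret J: ideal J R by fact
  interpret K: ideal K R by fact
  interpret P: ideal "J \<cdot> K" R by (rule ideal_prod_is_ideal[OF J K])
  interpret E: ideal "ext (J \<cdot> K)" "localization R S" by (rule ext_ideal[OF P.is_ideal])
  interpret EP: ideal "ext J \<cdot>\<^bsub>localization R S\<^esub> ext K" "localization R S"
    by (intro L.ideal_prod_is_ideal ext_ideal J K)
  show "ext (J \<cdot> K) \<subseteq> ext J \<cdot>\<^bsub>localization R S\<^esub> ext K"
  proof
    fix x assume "x \<in> ext (J \<cdot> K)"
    then obtain a s where x: "x = fraction R S a s" and a: "a \<in> J \<cdot> K" and s: "s \<in> S"
      by (auto simp: ext_def)
    \<comment> \<open>With denominator \<open>\<one>\<close>, sums of products in
      \<open>J \<cdot> K\<close> map to sums of products; the factor \<open>1/s\<close> is restored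
      afterwards by absorption.\<close>
    from a have "fraction R S a \<one> \<in> ext J \<cdot>\<^bsub>localization R S\<^esub> ext K"
    proof (induction rule: ideal_prod.induct)
      case (prod i j)
      have "fraction R S i \<one> \<otimes>\<^bsub>localization R S\<^esub> fraction R S j \<one> \<in> ext J \<cdot>\<^bsub>localization R S\<^esub> ext K"
        using prod by (intro ideal_prod.prod) (auto intro: extI)
      then show ?case using prod by (simp add: fraction_mult)
    next
      case (sum a b)
      have "fraction R S a \<one> \<oplus>\<^bsub>localization R S\<^esub> fraction R S b \<one> \<in> ext J \<cdot>\<^bsub>localization R S\<^esub> ext K"
        using sum by (intro ideal_prod.sum)
      then show ?case using sum by (simp add: fraction_add)
    qed
    then have "fraction R S a \<one> \<otimes>\<^bsub>localization R S\<^esub> fraction R S \<one> s \<in> ext J \<cdot>\<^bsub>localization R S\<^esub> ext K"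
      using s by (intro EP.I_r_closed) auto
    then show "x \<in> ext J \<cdot>\<^bsub>localization R S\<^esub> ext K"
      using a s x by (simp add: fraction_mult)
  qed
  show "ext J \<cdot>\<^bsub>localization R S\<^esub> ext K \<subseteq> ext (J \<cdot> K)"
  proof
    fix x assume "x \<in> ext J \<cdot>\<^bsub>localization R S\<^esub> ext K"
    then show "x \<in> ext (J \<cdot> K)"
    proof (induction rule: ideal_prod.induct)
      case (prod x y)
      then obtain a s b u where "x = fraction R S a s" "a \<in> J" "s \<in> S"
        "y = fraction R S b u" "b \<in> K" "u \<in> S" by (auto simp: ext_def)
      then show ?case
        by (auto simp: fraction_mult intro!: extI ideal_prod.prod)
    next
      case (sum x y)
      then show ?case by simp
    qed
  qed
qed

lemma ext_ideal_pow:
  assumes J: "ideal J R"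
  shows "ext (ideal_pow R J n) = ideal_pow (localization R S) (ext J) n"
  by (induction n) (simp_all add: ext_carrier ext_ideal_prod J ideal_pow_ideal)

end

lemma (in primeideal) localization_at: "cring_localization R (carrier R - I)"
  by (unfold_locales) (use I_notcarr one_imp_carrier I_prime in auto)

section \<open>The associated graded ring\<close>

lemma mem_a_r_cosetE:
  assumes "x \<in> H +>\<^bsub>R\<^esub> a"
  obtains u where "u \<in> H" "x = u \<oplus>\<^bsub>R\<^esub> a"
  using assms unfolding a_r_coset_def' by blast

context ideal
begin

lemma finsum_mem: "f \<in> A \<rightarrow> I \<Longrightarrow> finsum R f A \<in> I"
proof (induction A rule: infinite_finite_induct)
  case (insert x A)
  then have "finsum R f (insert x A) = f x \<oplus> finsum R f A"
    using Icarr by (intro finsum_insert) (auto simp: Pi_iff)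
  then show ?case using insert by simp
qed simp_all

lemma rcos_eq_iff: "a \<in> carrier R \<Longrightarrow> b \<in> carrier R \<Longrightarrow> I +> a = I +> b \<longleftrightarrow> a \<ominus> b \<in> I"
  using quotient_eq_iff_same_a_r_cos[OF is_ideal] by auto

lemma rcos_eq_self: "a \<in> I \<Longrightarrow> I +> a = I"
  by (simp add: a_rcos_zero[OF is_ideal])

lemma rcos_finsum:
  assumes "f \<in> A \<rightarrow> carrier R"
  shows "(\<Oplus>\<^bsub>R Quot I\<^esub>i\<in>A. I +> f i) = I +> (\<Oplus>i\<in>A. f i)"
  using ring_hom_ring.hom_finsum[OF rcos_ring_hom_ring assms] by (simp add: comp_def)

end

context ring
begin

text \<open>The two cosets are taken modulo different powers, \<open>i + 1\<close> and
  \<open>j + 1\<close>. For \<open>x = u \<oplus> a\<close> and \<open>y = v \<oplus> b\<close>, the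
  difference \<open>x \<otimes> y \<ominus> a \<otimes> b\<close> equals
  \<open>u \<otimes> y \<oplus> a \<otimes> v\<close>, and both terms lie in the power
  \<open>i + j + 1\<close>. Thus the multiplication of the associated graded ring can be computed on
  representatives.\<close>

lemma rcoset_mult_ideal_pow:
  assumes J: "ideal J R" and a: "a \<in> ideal_pow R J i" and b: "b \<in> ideal_pow R J j"
  shows "rcoset_mult R (ideal_pow R J (Suc (i + j)))
      (ideal_pow R J (Suc i) +> a) (ideal_pow R J (Suc j) +> b) =
    ideal_pow R J (Suc (i + j)) +> a \<otimes> b"
proof -
  note pow = ideal_pow_ideal[OF J]
  note carr = ideal.Icarr[OF pow]
  let ?K = "ideal_pow R J (Suc (i + j))"
  interpret K: ideal ?K R by (rule pow)
  interpret Ki: ideal "ideal_pow R J (Suc i)" R by (rule pow)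
  interpret Kj: ideal "ideal_pow R J (Suc j)" R by (rule pow)
  have eq: "?K +> x \<otimes> y = ?K +> a \<otimes> b"
    if "x \<in> ideal_pow R J (Suc i) +> a" "y \<in> ideal_pow R J (Suc j) +> b" for x y
  proof -
    note xy = that
    obtain u where u: "u \<in> ideal_pow R J (Suc i)" "x = u \<oplus> a"
      using xy(1) by (rule mem_a_r_cosetE)
    obtain v where v: "v \<in> ideal_pow R J (Suc j)" "y = v \<oplus> b"
      using xy(2) by (rule mem_a_r_cosetE)
    have [simp]: "u \<in> carrier R" "v \<in> carrier R" "a \<in> carrier R" "b \<in> carrier R"
      by (rule carr[OF u(1)] carr[OF v(1)] carr[OF a] carr[OF b])+
    have "v \<in> ideal_pow R J j" using v(1) ideal_pow_Suc_subset[OF J, of j] by blast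
    then have y: "y \<in> ideal_pow R J j"
      unfolding v(2) by (rule additive_subgroup.a_closed[OF ideal.axioms(1)[OF pow] _ b])
    have "u \<otimes> y \<in> ?K" "a \<otimes> v \<in> ?K"
      using ideal_pow_mult[OF J u(1) y] ideal_pow_mult[OF J a v(1)] by simp_all
    moreover have "x \<otimes> y \<ominus> a \<otimes> b = u \<otimes> y \<oplus> a \<otimes> v"
    proof -
      have "x \<otimes> y = u \<otimes> y \<oplus> (a \<otimes> v \<oplus> a \<otimes> b)"
        unfolding u(2) v(2) by (simp add: l_distr r_distr a_ac)
      then show ?thesis unfolding v(2) by (simp add: a_minus_def a_assoc r_neg)
    qed
    ultimately have "x \<otimes> y \<ominus> a \<otimes> b \<in> ?K" by (simp only: K.a_closed)
    then show ?thesis using u v by (intro K.rcos_eq_iff[THEN iffD2]) auto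
  qed
  have "a \<in> ideal_pow R J (Suc i) +> a" "b \<in> ideal_pow R J (Suc j) +> b"
    by (rule Ki.a_rcos_self[OF carr[OF a]] Kj.a_rcos_self[OF carr[OF b]])+
  then show ?thesis unfolding rcoset_mult_def using eq by blast
qed

text \<open>The associated graded ring is an image of the Rees ring \<open>\<Oplus>\<^sub>k J\<^sup>k X\<^sup>k\<close>, a subring of the polynomial ring.\<close>

lemma assoc_graded_ring_ring:
  assumes J: "ideal J R"
  shows "ring (assoc_graded_ring R J)"
proof -
  note pow = ideal_pow_ideal[OF J]
  note carr = ideal.Icarr[OF pow]
  note pow_add = additive_subgroup.a_closed[OF ideal.axioms(1)[OF pow]]
  let ?K = "ideal_pow R J" and ?G = "assoc_graded_ring R J"
  interpret P: UP_ring R "UP R" by unfold_locales simp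
  note U = P.UP_ring
  define H where "H = {p \<in> carrier (UP R). \<forall>k. p k \<in> ?K k}"
  \<comment> \<open>\<open>H\<close> is the Rees ring and \<open>h\<close> reduces its coefficients.
    Once \<open>h\<close> is multiplicative, additive and onto \<open>?G\<close>, the ring axioms of
    \<open>?G\<close> are inherited as those of a homomorphic image.\<close>
  define h where "h p = (\<lambda>k. ?K (Suc k) +> p k)" for p :: "nat \<Rightarrow> 'a"
  have zero: "\<zero> \<in> ?K k" for k by (rule additive_subgroup.zero_closed[OF ideal.axioms(1)[OF pow]])
  have mult: "p \<otimes>\<^bsub>UP R\<^esub> q = (\<lambda>k. \<Oplus>i\<in>{..k}. p i \<otimes> q (k - i))"
    and add: "p \<oplus>\<^bsub>UP R\<^esub> q = (\<lambda>k. p k \<oplus> q k)"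
    if "p \<in> H" "q \<in> H" for p q
    using that by (simp_all add: H_def UP_def)
  have prod_mem: "p i \<otimes> q (k - i) \<in> ?K k" if "p \<in> H" "q \<in> H" "i \<le> k" for p q i k
    using ideal_pow_mult[OF J, of "p i" i "q (k - i)" "k - i"] that by (simp add: H_def)
  have subring: "subring H (UP R)"
  proof (rule ring.subringI[OF U])
    show "H \<subseteq> carrier (UP R)" by (auto simp: H_def)
    show "\<one>\<^bsub>UP R\<^esub> \<in> H" using zero by (auto simp: H_def) (simp add: UP_def)
    show "\<ominus>\<^bsub>UP R\<^esub> p \<in> H" if "p \<in> H" for p
    proof -
      have "(\<lambda>i. \<ominus> p i) \<in> H"
        using that additive_subgroup.a_inv_closed[OF ideal.axioms(1)[OF pow]]
        by (auto simp: H_def UP_def up_a_inv_closed)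
      moreover have "(\<lambda>i. \<ominus> p i) \<oplus>\<^bsub>UP R\<^esub> p = \<zero>\<^bsub>UP R\<^esub>"
        using that \<open>(\<lambda>i. \<ominus> p i) \<in> H\<close>
        by (subst add) (auto simp: H_def UP_def intro!: l_neg)
      ultimately show ?thesis
        using that abelian_group.minus_equality[OF ring.is_abelian_group[OF U], of "\<lambda>i. \<ominus> p i" p]
        by (simp add: H_def)
    qed
    show "p \<otimes>\<^bsub>UP R\<^esub> q \<in> H" if "p \<in> H" "q \<in> H" for p q
    proof -
      have "(\<Oplus>i\<in>{..k}. p i \<otimes> q (k - i)) \<in> ?K k" for k
        by (rule ideal.finsum_mem[OF pow]) (use prod_mem that in auto)
      moreover have "p \<otimes>\<^bsub>UP R\<^esub> q \<in> carrier (UP R)"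
        using that by (intro P.UP_mult_closed) (simp_all add: H_def)
      ultimately show ?thesis unfolding mult[OF that] by (simp add: H_def)
    qed
    show "p \<oplus>\<^bsub>UP R\<^esub> q \<in> H" if "p \<in> H" "q \<in> H" for p q
    proof -
      have "p \<oplus>\<^bsub>UP R\<^esub> q \<in> carrier (UP R)"
        using that by (intro P.UP_a_closed) (simp_all add: H_def)
      moreover have "p k \<oplus> q k \<in> ?K k" for k
        using that by (intro pow_add) (simp_all add: H_def)
      ultimately show ?thesis unfolding add[OF that] by (simp add: H_def)
    qed
  qed
  have hom: "h \<in> ring_hom (UP R\<lparr>carrier := H\<rparr>) ?G"
  proof (rule ring_hom_memI)
    show "h p \<in> carrier ?G" if "p \<in> carrier (UP R\<lparr>carrier := H\<rparr>)" for p
    proof -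
      have "p \<in> up R" using that by (simp add: H_def UP_def)
      then obtain n where n: "bound \<zero> n p" by (auto dest: bound_upD)
      have tail: "h p k = ?K (Suc k)" if "n < k" for k
      proof -
        have "p k = \<zero>" using n that by (simp add: bound_def)
        then show ?thesis by (simp only: h_def ideal.rcos_eq_self[OF pow zero])
      qed
      have "{k. h p k \<noteq> ?K (Suc k)} \<subseteq> {..n}"
      proof
        fix k assume "k \<in> {k. h p k \<noteq> ?K (Suc k)}"
        then have "\<not> n < k" using tail[of k] by blast
        then show "k \<in> {..n}" by simp
      qed
      then have "finite {k. h p k \<noteq> ?K (Suc k)}" by (rule finite_subset) simp
      then show ?thesis using that by (simp add: assoc_graded_ring_def h_def H_def)
    qed
    fix p q assume "p \<in> carrier (UP R\<lparr>carrier := H\<rparr>)" "q \<in> carrier (UP R\<lparr>carrier := H\<rparr>)"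
    then have p: "p \<in> H" and q: "q \<in> H" by simp_all
    have pc: "p i \<in> ?K i" and qc: "q i \<in> ?K i" for i using p q by (simp_all add: H_def)
    show "h (p \<oplus>\<^bsub>UP R\<lparr>carrier := H\<rparr>\<^esub> q) = h p \<oplus>\<^bsub>?G\<^esub> h q"
      using carr[OF pc] carr[OF qc]
      by (simp add: add[OF p q] h_def assoc_graded_ring_def ideal.a_rcos_sum[OF pow]
          del: ideal_pow_simps Group.nat_pow_Suc)
    show "h (p \<otimes>\<^bsub>UP R\<lparr>carrier := H\<rparr>\<^esub> q) = h p \<otimes>\<^bsub>?G\<^esub> h q"
    proof
      fix k
      interpret Q: ring "R Quot ?K (Suc k)" by (rule ideal.quotient_is_ring[OF pow])
      have pq: "(\<lambda>i. p i \<otimes> q (k - i)) \<in> {..k} \<rightarrow> carrier R"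
        using carr[OF pc] carr[OF qc] by auto
      have term_eq: "rcoset_mult R (?K (Suc k)) (h p i) (h q (k - i)) = ?K (Suc k) +> p i \<otimes> q (k - i)"
        if "i \<le> k" for i
        using rcoset_mult_ideal_pow[OF J pc[of i] qc[of "k - i"]] that
        unfolding h_def by (simp only: le_add_diff_inverse)
      have "(h p \<otimes>\<^bsub>?G\<^esub> h q) k =
          (\<Oplus>\<^bsub>R Quot ?K (Suc k)\<^esub>i\<in>{..k}. rcoset_mult R (?K (Suc k)) (h p i) (h q (k - i)))"
        by (simp only: assoc_graded_ring_def monoid.simps)
      also have "\<dots> = (\<Oplus>\<^bsub>R Quot ?K (Suc k)\<^esub>i\<in>{..k}. ?K (Suc k) +> p i \<otimes> q (k - i))"
        by (rule Q.finsum_cong') (use pq term_eq in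
          \<open>auto simp only: FactRing_def partial_object.simps atMost_iff Pi_iff
             intro!: a_rcosetsI additive_subgroup.a_subset[OF ideal.axioms(1)[OF pow]]\<close>)
      also have "\<dots> = ?K (Suc k) +> (\<Oplus>i\<in>{..k}. p i \<otimes> q (k - i))"
        by (rule ideal.rcos_finsum[OF pow pq])
      finally show "h (p \<otimes>\<^bsub>UP R\<lparr>carrier := H\<rparr>\<^esub> q) k = (h p \<otimes>\<^bsub>?G\<^esub> h q) k"
        by (simp add: mult[OF p q] h_def)
    qed
  next
    show "h \<one>\<^bsub>UP R\<lparr>carrier := H\<rparr>\<^esub> = \<one>\<^bsub>?G\<^esub>"
      by (simp add: h_def assoc_graded_ring_def UP_def)
  qed
  have "carrier ?G \<subseteq> h ` H"
  proof
    fix f assume f: "f \<in> carrier ?G"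
    then have "\<forall>k. \<exists>x\<in>?K k. f k = ?K (Suc k) +> x"
      by (auto simp only: assoc_graded_ring_def partial_object.simps)
    \<comment> \<open>Zero cosets are lifted to \<open>\<zero>\<close> itself; otherwise the lifted
      sequence could have infinite support and fail to be a polynomial.\<close>
    moreover have "f k = ?K (Suc k) +> \<zero>" if "f k = ?K (Suc k)" for k
      using that ideal.rcos_eq_self[OF pow zero, of "Suc k"] by simp
    ultimately have "\<forall>k. \<exists>x\<in>?K k. f k = ?K (Suc k) +> x \<and> (f k = ?K (Suc k) \<longrightarrow> x = \<zero>)"
      using zero by metis
    then obtain p where p: "\<And>k. p k \<in> ?K k" "\<And>k. f k = ?K (Suc k) +> p k"
        "\<And>k. f k = ?K (Suc k) \<Longrightarrow> p k = \<zero>" by metis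
    have "finite {k. f k \<noteq> ?K (Suc k)}"
      using f by (simp only: assoc_graded_ring_def partial_object.simps mem_Collect_eq)
    then obtain n where "\<forall>k\<in>{k. f k \<noteq> ?K (Suc k)}. k \<le> n"
      using finite_nat_set_iff_bounded_le by blast
    then have "bound \<zero> n p" using p(3) by (intro bound.intro) force
    then have "p \<in> H" using p(1) carr[OF p(1)] by (auto simp: H_def UP_def)
    moreover have "f = h p" using p(2) by (auto simp only: h_def)
    ultimately show "f \<in> h ` H" by blast
  qed
  moreover have "h ` H \<subseteq> carrier ?G" using ring_hom_memE(1)[OF hom] by auto
  ultimately have "carrier ?G = h ` carrier (UP R\<lparr>carrier := H\<rparr>)" by auto
  moreover have "h \<zero>\<^bsub>UP R\<lparr>carrier := H\<rparr>\<^esub> = \<zero>\<^bsub>?G\<^esub>"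
    using ideal.rcos_eq_self[OF pow zero] by (simp add: h_def UP_def assoc_graded_ring_def
        del: ideal_pow_simps Group.nat_pow_Suc)
  \<comment> \<open>The image ring comes as a record whose carrier and zero have been overwritten;
    here these updates change nothing.\<close>
  moreover have "?G\<lparr>carrier := carrier ?G, zero := \<zero>\<^bsub>?G\<^esub>\<rparr> = ?G"
    by (simp add: assoc_graded_ring_def)
  ultimately show ?thesis
    using ring.ring_hom_imp_img_ring[OF ring.subring_is_ring[OF U subring] hom] by metis
qed

end

text \<open>If \<open>f\<close> lies in \<open>J\<^sup>s\<close> but not in \<open>J\<^sup>s\<^sup>+\<^sup>1\<close> for some \<open>s < t\<close>, then its initial form is a non-zero
  element of the associated graded ring annihilated by the whole homogeneous maximal ideal.\<close>

lemma (in cring) mem_ideal_pow_of_depth_gr_pos: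
  assumes J: "ideal J R" and m: "J \<subseteq> m" "m \<subseteq> carrier R"
    and depth: "1 \<le> depth (assoc_graded_ring R J) (assoc_graded_max_ideal R J m)"
    and f: "f \<in> carrier R" and mf: "\<And>x. x \<in> m \<Longrightarrow> x \<otimes> f \<in> ideal_pow R J (Suc t)"
  shows "f \<in> ideal_pow R J t"
proof -
  note pow = ideal_pow_ideal[OF J]
  note carr = ideal.Icarr[OF pow]
  note zero = additive_subgroup.zero_closed[OF ideal.axioms(1)[OF pow]]
  let ?K = "ideal_pow R J" and ?G = "assoc_graded_ring R J"
  have "0 < depth ?G (assoc_graded_max_ideal R J m)"
    using depth by (metis i0_less not_one_le_zero)
  then obtain xs where xs: "regular_sequence ?G xs" "set xs \<subseteq> assoc_graded_max_ideal R J m" "xs \<noteq> []"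
    unfolding depth_def less_SUP_iff by (auto simp: zero_enat_def)
  define x where "x = xs ! 0"
  have x: "x \<in> assoc_graded_max_ideal R J m" using xs(2,3) by (auto simp: x_def)
  interpret G: ring ?G by (rule assoc_graded_ring_ring[OF J])
  \<comment> \<open>Regularity of the first entry of \<open>xs\<close> is tested modulo the ideal
    generated by the empty set. As this is zero, \<open>x\<close> is a non-zero-divisor of
    \<open>?G\<close>, possibly inhomogeneous.\<close>
  have Idl: "genideal ?G {} = {\<zero>\<^bsub>?G\<^esub>}"
    using G.genideal_minimal[OF G.zeroideal, of "{}"] G.genideal_ideal[of "{}"]
      additive_subgroup.zero_closed[OF ideal.axioms(1)] by blast
  have regular: "a = \<zero>\<^bsub>?G\<^esub>" if "a \<in> carrier ?G" "x \<otimes>\<^bsub>?G\<^esub> a = \<zero>\<^bsub>?G\<^esub>" for a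
  proof -
    have "\<forall>a\<in>carrier ?G. xs ! 0 \<otimes>\<^bsub>?G\<^esub> a \<in> genideal ?G (set (take 0 xs)) \<longrightarrow>
        a \<in> genideal ?G (set (take 0 xs))"
      using xs(1,3) unfolding regular_sequence_def by blast
    then show ?thesis using that by (simp add: Idl x_def)
  qed
  have "x \<in> carrier ?G" using x by (simp add: assoc_graded_max_ideal_def)
  then have "\<forall>k. \<exists>z\<in>?K k. x k = ?K (Suc k) +> z"
    by (auto simp only: assoc_graded_ring_def partial_object.simps)
  \<comment> \<open>In degree \<open>0\<close> the representative must be chosen in
    \<open>m\<close>, since \<open>mf\<close> speaks of elements of \<open>m\<close> only.\<close>
  moreover have "\<exists>z\<in>m. x 0 = ?K (Suc 0) +> z"
  proof -
    have "?K (Suc 0) = J"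
      using ideal_prod_one[OF J] ideal_prod_commute[OF oneideal J] by simp
    then show ?thesis using x by (auto simp: assoc_graded_max_ideal_def)
  qed
  ultimately have "\<forall>k. \<exists>z\<in>?K k. x k = ?K (Suc k) +> z \<and> (k = 0 \<longrightarrow> z \<in> m)"
    using m(2) by (metis ideal_pow_simps(1) subsetD)
  then obtain z where z: "\<And>k. z k \<in> ?K k" "\<And>k. x k = ?K (Suc k) +> z k" "z 0 \<in> m"
    by metis
  \<comment> \<open>Of the \<open>i + 1\<close> factors from \<open>J\<close>, one is spent on
    \<open>f\<close> through \<open>J \<subseteq> m\<close> and contributes \<open>Suc t\<close>;
    the other \<open>i\<close> add to the exponent.\<close>
  have Kf: "y \<otimes> f \<in> ?K (i + Suc t)" if "y \<in> ?K (Suc i)" for y i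
  proof -
    have "y \<in> ?K i \<cdot> J" using that by simp
    then show ?thesis
    proof (induction rule: ideal_prod.induct)
      case (prod a b)
      then have "a \<in> carrier R" "b \<in> carrier R" using carr[of a i] ideal.Icarr[OF J] by blast+
      then have "a \<otimes> b \<otimes> f = a \<otimes> (b \<otimes> f)" using f by (simp add: m_assoc)
      also have "\<dots> \<in> ?K (i + Suc t)"
        by (rule ideal_pow_mult[OF J]) (use prod m mf in auto)
      finally show ?case .
    next
      case (sum a b)
      then have "a \<in> carrier R" "b \<in> carrier R"
        using ideal_prod_in_carrier[OF pow J] by blast+
      then have "(a \<oplus> b) \<otimes> f = a \<otimes> f \<oplus> b \<otimes> f" using f by (simp add: l_distr)
      also have "\<dots> \<in> ?K (i + Suc t)"
        by (rule additive_subgroup.a_closed[OF ideal.axioms(1)[OF pow] sum.IH])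
      finally show ?case .
    qed
  qed
  \<comment> \<open>The exponent is raised one step at a time: \<open>x\<close> annihilates the
    class of \<open>f\<close> in degree \<open>s\<close>, so this class is zero and \<open>f\<close>
    lies in the next power.\<close>
  have "s \<le> t \<Longrightarrow> f \<in> ?K s" for s
  proof (induction s)
    case 0
    then show ?case using f by simp
  next
    case (Suc s)
    then have fs: "f \<in> ?K s" and "s < t" by simp_all
    define b where "b k = (if k = s then f else \<zero>)" for k
    define a where "a k = ?K (Suc k) +> b k" for k
    have b: "b k \<in> ?K k" for k using fs zero by (simp add: b_def)
    have a: "a \<in> carrier ?G"
    proof -
      have "{k. a k \<noteq> ?K (Suc k)} \<subseteq> {s}"
        using ideal.rcos_eq_self[OF pow zero] by (auto simp only: a_def b_def if_False singleton_iff)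
      then have "finite {k. a k \<noteq> ?K (Suc k)}" by (rule finite_subset) simp
      then show ?thesis using b by (simp add: assoc_graded_ring_def a_def)
    qed
    have term_mem: "z i \<otimes> b (k - i) \<in> ?K (Suc k)" if "i \<le> k" for i k
    proof (cases "k - i = s")
      case False
      then show ?thesis using carr[OF z(1)] zero[of "Suc k"] by (simp add: b_def)
    next
      case True
      \<comment> \<open>For \<open>i = 0\<close> the exponent \<open>t + 1\<close> from
        \<open>mf\<close> is more than enough. For \<open>i = j + 1\<close>, \<open>Kf\<close> gives
        \<open>j + t + 1\<close>, while \<open>j + s + 2\<close> is required; this is where
        \<open>s < t\<close> is essential.\<close>
      have "z i \<otimes> f \<in> ?K (Suc (i + s))"
      proof (cases i)
        case 0
        then show ?thesis
          using mf[OF z(3)] ideal_pow_antimono[OF J, of "Suc s" "Suc t"] \<open>s < t\<close> by auto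
      next
        case (Suc j)
        then show ?thesis
          using Kf[of "z i" j] z(1)[of i] ideal_pow_antimono[OF J, of "Suc (i + s)" "j + Suc t"] \<open>s < t\<close>
          by auto
      qed
      moreover have "i + s = k" using True that by simp
      ultimately show ?thesis using True by (simp only: b_def if_True simp_thms)
    qed
    have "x \<otimes>\<^bsub>?G\<^esub> a = \<zero>\<^bsub>?G\<^esub>"
    proof
      fix k
      interpret Q: ring "R Quot ?K (Suc k)" by (rule ideal.quotient_is_ring[OF pow])
      have term_eq: "rcoset_mult R (?K (Suc k)) (x i) (a (k - i)) = \<zero>\<^bsub>R Quot ?K (Suc k)\<^esub>"
        if "i \<in> {..k}" for i
      proof -
        have ik: "i + (k - i) = k" using that by simp
        have "rcoset_mult R (?K (Suc k)) (x i) (a (k - i)) = ?K (Suc k) +> z i \<otimes> b (k - i)"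
          using rcoset_mult_ideal_pow[OF J z(1)[of i] b[of "k - i"]]
          unfolding a_def z(2) ik .
        also have "\<dots> = ?K (Suc k)"
          using that by (intro ideal.rcos_eq_self[OF pow] term_mem) simp
        finally show ?thesis by (simp only: FactRing_def ring.simps)
      qed
      have "(x \<otimes>\<^bsub>?G\<^esub> a) k = (\<Oplus>\<^bsub>R Quot ?K (Suc k)\<^esub>i\<in>{..k}. rcoset_mult R (?K (Suc k)) (x i) (a (k - i)))"
        by (simp only: assoc_graded_ring_def monoid.simps)
      also have "\<dots> = (\<Oplus>\<^bsub>R Quot ?K (Suc k)\<^esub>i\<in>{..k}. \<zero>\<^bsub>R Quot ?K (Suc k)\<^esub>)"
        by (rule Q.finsum_cong'[OF refl _ term_eq]) (rule funcsetI, rule Q.zero_closed)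
      also have "\<dots> = \<zero>\<^bsub>?G\<^esub> k"
        unfolding Q.finsum_zero by (simp only: FactRing_def assoc_graded_ring_def ring.simps)
      finally show "(x \<otimes>\<^bsub>?G\<^esub> a) k = \<zero>\<^bsub>?G\<^esub> k" .
    qed
    then have "a = \<zero>\<^bsub>?G\<^esub>" by (rule regular[OF a])
    then have "a s = \<zero>\<^bsub>?G\<^esub> s" by simp
    then have "?K (Suc s) +> f = ?K (Suc s)"
      by (simp only: a_def b_def if_True simp_thms assoc_graded_ring_def ring.simps)
    then show ?case by (rule ideal.rcos_const_imp_mem[OF pow f])
  qed
  then show ?thesis by simp
qed

section \<open>Monomial ideals\<close>

context cring
begin

text \<open>Elements outside \<open>m\<close> enter with exponent \<open>0\<close>. Two monomials
  can therefore be written over one index set and multiplied factor by factor.\<close>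

lemma monomial_superset:
  assumes "finite A" "set_mset m \<subseteq> A" "A \<subseteq> carrier R"
  shows "monomial R m = (\<Otimes>x\<in>A. x [^] count m x)"
  unfolding monomial_def using assms
  by (intro finprod_mono_neutral_cong_left) (auto simp: not_in_iff)

lemma monomial_closed [simp]: "set_mset m \<subseteq> carrier R \<Longrightarrow> monomial R m \<in> carrier R"
  unfolding monomial_def by (intro finprod_closed) auto

lemma monomial_union:
  assumes "set_mset m \<subseteq> carrier R" "set_mset n \<subseteq> carrier R"
  shows "monomial R (m + n) = monomial R m \<otimes> monomial R n"
proof -
  let ?A = "set_mset m \<union> set_mset n"
  have A: "finite ?A" "?A \<subseteq> carrier R" using assms by auto
  have "monomial R (m + n) = (\<Otimes>x\<in>?A. x [^] (count m x + count n x))"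
    using monomial_superset[of ?A "m + n"] A by simp
  also have "\<dots> = (\<Otimes>x\<in>?A. x [^] count m x \<otimes> x [^] count n x)"
    using A by (intro finprod_cong') (auto simp: nat_pow_mult)
  also have "\<dots> = (\<Otimes>x\<in>?A. x [^] count m x) \<otimes> (\<Otimes>x\<in>?A. x [^] count n x)"
    using A by (intro finprod_multf) auto
  also have "\<dots> = monomial R m \<otimes> monomial R n"
    using monomial_superset[of ?A m] monomial_superset[of ?A n] A by simp
  finally show ?thesis .
qed

lemma monomial_empty [simp]: "monomial R {#} = \<one>"
  by (simp add: monomial_def)

lemma monomial_single [simp]: "x \<in> carrier R \<Longrightarrow> monomial R {#x#} = x"
  by (simp add: monomial_def)

end

lemma (in primeideal) variable_mem_of_monomial_mem:
  assumes "monomial R m \<in> I" "set_mset m \<subseteq> carrier R"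
  obtains x where "x \<in># m" "x \<in> I"
proof -
  have "\<exists>x\<in>#m. x \<in> I" using assms
  proof (induction m)
    case empty
    then show ?case using one_imp_carrier I_notcarr by simp
  next
    case (add x m)
    then have "x \<otimes> monomial R m \<in> I"
      using monomial_union[of "{#x#}" m] by simp
    then show ?case using I_prime[of x "monomial R m"] add by auto
  qed
  then show thesis using that by blast
qed

section \<open>Polynomial rings as spans of monomials\<close>

locale polynomial_ring_in = cring R for R (structure) and K V +
  assumes subring: "subring K R" and poly: "is_polynomial_ring R K V"
begin

abbreviation monomials :: "'a multiset set" where
  "monomials \<equiv> {m. set_mset m \<subseteq> V}"

definition peval :: "('a multiset \<Rightarrow> 'a) \<Rightarrow> 'a" where
  "peval c = finsum R (\<lambda>m. c m \<otimes> monomial R m) {m. c m \<noteq> \<zero>}"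

text \<open>These are the \<open>K\<close>-linear combinations of monomials with exponents in
  \<open>U\<close>. Building them term by term, with repetitions allowed, gives closure properties
  by rule induction; \<open>peval_mem_span\<close> and \<open>spanE\<close> connect them with
  coefficient functions.\<close>

inductive_set span :: "'a multiset set \<Rightarrow> 'a set" for U where
  zero: "\<zero> \<in> span U"
| add: "\<lbrakk>k \<in> K; m \<in> U; r \<in> span U\<rbrakk> \<Longrightarrow> k \<otimes> monomial R m \<oplus> r \<in> span U"

lemma V_subset: "V \<subseteq> carrier R"
  using poly by (simp add: is_polynomial_ring_def)

lemma bij_peval: "bij_betw peval (indexed_pset V K) (carrier R)"
  using poly by (simp add: is_polynomial_ring_def peval_def[abs_def])

lemmas K_simps [simp] = subringE(2,3,5-7)[OF subring]

lemma K_carrier [simp]: "k \<in> K \<Longrightarrow> k \<in> carrier R"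
  using subringE(1)[OF subring] by blast

lemma monomial_carrier [simp]: "m \<in> monomials \<Longrightarrow> monomial R m \<in> carrier R"
  using V_subset by auto

lemma monomial_mult:
  "m \<in> monomials \<Longrightarrow> n \<in> monomials \<Longrightarrow> monomial R (m + n) = monomial R m \<otimes> monomial R n"
  using V_subset by (intro monomial_union) auto

lemma psetD:
  assumes "c \<in> indexed_pset V K"
  shows "c m \<in> K" "finite {m. c m \<noteq> \<zero>}" "{m. c m \<noteq> \<zero>} \<subseteq> monomials"
proof -
  have "(\<forall>m. c m \<in> K) \<and> finite {m. c m \<noteq> \<zero>} \<and> {m. c m \<noteq> \<zero>} \<subseteq> monomials"
    using assms
  proof induction
    case (indexed_const k)
    have "{m. indexed_const k m \<noteq> \<zero>} \<subseteq> {{#} :: 'a multiset}" by (auto simp: indexed_const_def)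
    then show ?case using indexed_const finite_subset by (fastforce simp: indexed_const_def)
  next
    case (indexed_padd P Q)
    have sub: "{m. indexed_padd P Q m \<noteq> \<zero>} \<subseteq> {m. P m \<noteq> \<zero>} \<union> {m. Q m \<noteq> \<zero>}"
      by (auto simp: indexed_padd_def)
    have "finite {m. indexed_padd P Q m \<noteq> \<zero>}"
      by (rule finite_subset[OF sub]) (use indexed_padd.IH in simp)
    moreover have "{m. indexed_padd P Q m \<noteq> \<zero>} \<subseteq> monomials"
      by (rule subset_trans[OF sub]) (use indexed_padd.IH in simp)
    ultimately show ?case using indexed_padd.IH by (simp add: indexed_padd_def[of P Q])
  next
    case (indexed_pmult P i)
    have sub: "{m. indexed_pmult P i m \<noteq> \<zero>} \<subseteq> add_mset i ` {m. P m \<noteq> \<zero>}"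
      by (auto simp: indexed_pmult_def split: if_splits intro!: image_eqI[where x = "_ - {#i#}"])
    have "finite {m. indexed_pmult P i m \<noteq> \<zero>}"
      by (rule finite_subset[OF sub]) (use indexed_pmult.IH in simp)
    moreover have "add_mset i ` {m. P m \<noteq> \<zero>} \<subseteq> monomials"
      using indexed_pmult by (auto dest!: subsetD)
    then have "{m. indexed_pmult P i m \<noteq> \<zero>} \<subseteq> monomials"
      by (rule subset_trans[OF sub])
    ultimately show ?case using indexed_pmult by (simp add: indexed_pmult_def)
  qed
  then show "c m \<in> K" "finite {m. c m \<noteq> \<zero>}" "{m. c m \<noteq> \<zero>} \<subseteq> monomials" by auto
qed

lemma pset_single:
  assumes "k \<in> K" "m \<in> monomials"
  shows "(\<lambda>n. if n = m then k else \<zero>) \<in> indexed_pset V K"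
  using assms(2)
proof (induction m)
  case empty
  show ?case using indexed_pset.indexed_const[OF assms(1), of V] by (simp add: indexed_const_def)
next
  case (add x m)
  then have "indexed_pmult (\<lambda>n. if n = m then k else \<zero>) x \<in> indexed_pset V K"
    by (intro indexed_pset.indexed_pmult) auto
  moreover have "indexed_pmult (\<lambda>n. if n = m then k else \<zero>) x =
      (\<lambda>n. if n = add_mset x m then k else \<zero>)"
    by (auto simp: indexed_pmult_def fun_eq_iff dest: multi_member_split)
  ultimately show ?case by simp
qed

lemma peval_superset:
  assumes "c \<in> indexed_pset V K" "finite A" "{m. c m \<noteq> \<zero>} \<subseteq> A" "A \<subseteq> monomials"
  shows "peval c = finsum R (\<lambda>m. c m \<otimes> monomial R m) A"
  unfolding peval_def using assms psetD(1)[OF assms(1)]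
  by (intro add.finprod_mono_neutral_cong_left) auto

lemma peval_padd:
  assumes c: "c \<in> indexed_pset V K" and d: "d \<in> indexed_pset V K"
  shows "peval (indexed_padd c d) = peval c \<oplus> peval d"
proof -
  let ?A = "{m. c m \<noteq> \<zero>} \<union> {m. d m \<noteq> \<zero>}"
  have A: "finite ?A" "?A \<subseteq> monomials" using psetD[OF c] psetD[OF d] by auto
  have sub: "{m. indexed_padd c d m \<noteq> \<zero>} \<subseteq> ?A" by (auto simp: indexed_padd_def)
  have "peval (indexed_padd c d) = finsum R (\<lambda>m. (c m \<oplus> d m) \<otimes> monomial R m) ?A"
    using peval_superset[OF indexed_pset.indexed_padd[OF c d] A(1) sub A(2)]
    by (simp add: indexed_padd_def)
  also have "\<dots> = finsum R (\<lambda>m. c m \<otimes> monomial R m \<oplus> d m \<otimes> monomial R m) ?A"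
    using A psetD(1)[OF c] psetD(1)[OF d]
    by (intro finsum_cong') (auto simp: l_distr subset_iff)
  also have "\<dots> = finsum R (\<lambda>m. c m \<otimes> monomial R m) ?A \<oplus> finsum R (\<lambda>m. d m \<otimes> monomial R m) ?A"
    using A psetD(1)[OF c] psetD(1)[OF d] by (intro finsum_addf) (auto simp: subset_iff)
  also have "\<dots> = peval c \<oplus> peval d"
    using peval_superset[OF c A(1) _ A(2)] peval_superset[OF d A(1) _ A(2)] by simp
  finally show ?thesis .
qed

lemma peval_single:
  assumes "k \<in> K" "m \<in> monomials"
  shows "peval (\<lambda>n. if n = m then k else \<zero>) = k \<otimes> monomial R m"
proof -
  have "{n. (if n = m then k else \<zero>) \<noteq> \<zero>} \<subseteq> {m}" by auto
  then show ?thesis using peval_superset[OF pset_single[OF assms], of "{m}"] assms by simp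
qed

text \<open>Multiplication by a variable shifts exponents along the injective map
  \<open>add_mset x\<close>, and the sum is reindexed accordingly. This is what relates the
  coefficients of \<open>x \<otimes> g\<close> to those of \<open>g\<close>.\<close>

lemma peval_pmult:
  assumes c: "c \<in> indexed_pset V K" and x: "x \<in> V"
  shows "peval (indexed_pmult c x) = x \<otimes> peval c"
proof -
  let ?A = "{m. c m \<noteq> \<zero>}"
  note A = psetD(2,3)[OF c]
  have x': "x \<in> carrier R" using x V_subset by blast
  have mon: "monomial R (add_mset x m) = x \<otimes> monomial R m" if "m \<in> ?A" for m
    using monomial_mult[of "{#x#}" m] that A(2) x x' by auto
  have sub: "{m. indexed_pmult c x m \<noteq> \<zero>} \<subseteq> add_mset x ` ?A"
    by (auto simp: indexed_pmult_def split: if_splits intro!: image_eqI[where x = "_ - {#x#}"])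
  have mem: "add_mset x ` ?A \<subseteq> monomials" using x by (auto dest!: subsetD[OF A(2)])
  have "peval (indexed_pmult c x) =
      finsum R (\<lambda>m. indexed_pmult c x m \<otimes> monomial R m) (add_mset x ` ?A)"
    by (rule peval_superset[OF indexed_pset.indexed_pmult[OF c x] _ sub mem]) (use A in simp)
  also have "\<dots> = finsum R (\<lambda>m. indexed_pmult c x (add_mset x m) \<otimes> monomial R (add_mset x m)) ?A"
    using mem psetD(1)[OF indexed_pset.indexed_pmult[OF c x]]
    by (intro finsum_reindex) (auto simp: subset_iff inj_on_def)
  also have "\<dots> = finsum R (\<lambda>m. x \<otimes> (c m \<otimes> monomial R m)) ?A"
    using A psetD(1)[OF c] x'
    by (intro finsum_cong') (auto simp: mon indexed_pmult_def m_ac subset_iff)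
  also have "\<dots> = x \<otimes> peval c"
    unfolding peval_def using A psetD(1)[OF c] x'
    by (intro finsum_rdistr[symmetric]) (auto simp: subset_iff)
  finally show ?thesis .
qed

lemma span_carrier: "U \<subseteq> monomials \<Longrightarrow> span U \<subseteq> carrier R"
proof
  fix x assume "x \<in> span U" "U \<subseteq> monomials"
  then show "x \<in> carrier R" by induction (auto simp: subset_iff)
qed

lemma peval_mem_span:
  assumes c: "c \<in> indexed_pset V K" and U: "{m. c m \<noteq> \<zero>} \<subseteq> U"
  shows "peval c \<in> span U"
proof -
  have "finsum R (\<lambda>m. c m \<otimes> monomial R m) A \<in> span U"
    if "finite A" "A \<subseteq> {m. c m \<noteq> \<zero>}" for A
    using that
  proof (induction A rule: finite_induct)
    case empty
    then show ?case by (simp add: span.zero)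
  next
    case (insert m A)
    have "finsum R (\<lambda>m. c m \<otimes> monomial R m) (insert m A) =
        c m \<otimes> monomial R m \<oplus> finsum R (\<lambda>m. c m \<otimes> monomial R m) A"
      using insert psetD(1,3)[OF c] by (intro finsum_insert) (auto simp: subset_iff)
    then show ?case using insert psetD(1)[OF c] U by (auto intro: span.add)
  qed
  then show ?thesis unfolding peval_def using psetD(2)[OF c] by blast
qed

text \<open>Adding up the single-term coefficient functions merges repeated exponents without
  leaving \<open>U\<close>. As \<open>peval\<close> is injective, the function obtained is the
  coefficient function of \<open>r\<close>, which makes spans useful for comparing
  exponents.\<close>

lemma spanE:
  assumes "r \<in> span U" "U \<subseteq> monomials"
  obtains c where "c \<in> indexed_pset V K" "{m. c m \<noteq> \<zero>} \<subseteq> U" "r = peval c"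
proof -
  have "\<exists>c\<in>indexed_pset V K. {m. c m \<noteq> \<zero>} \<subseteq> U \<and> r = peval c" using assms(1)
  proof induction
    case zero
    have "(\<lambda>_. \<zero>) \<in> indexed_pset V K"
      using pset_single[of \<zero> "{#}"] by simp
    then show ?case by (intro bexI[where x = "\<lambda>_. \<zero>"]) (auto simp: peval_def)
  next
    case (add k m r)
    then obtain c where c: "c \<in> indexed_pset V K" "{m. c m \<noteq> \<zero>} \<subseteq> U" "r = peval c" by blast
    let ?s = "\<lambda>n. if n = m then k else \<zero>"
    have m: "m \<in> monomials" using add assms(2) by blast
    note s = pset_single[OF add.hyps(1) m]
    have "{n. indexed_padd ?s c n \<noteq> \<zero>} \<subseteq> U"
      using add.hyps(2) c(2) psetD(1)[OF c(1)] by (auto simp: indexed_padd_def split: if_splits)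
    then show ?case
      using peval_padd[OF s c(1)] peval_single[OF add.hyps(1) m] c indexed_pset.indexed_padd[OF s c(1)]
      by auto
  qed
  then show thesis using that by blast
qed

lemma span_monomials: "span monomials = carrier R"
proof
  show "span monomials \<subseteq> carrier R" by (rule span_carrier) simp
  show "carrier R \<subseteq> span monomials"
  proof
    fix r assume "r \<in> carrier R"
    then obtain c where c: "c \<in> indexed_pset V K" "r = peval c"
      using bij_betw_imp_surj_on[OF bij_peval] by blast
    show "r \<in> span monomials" using peval_mem_span[OF c(1) psetD(3)[OF c(1)]] c(2) by simp
  qed
qed

lemma span_add: "r \<in> span U \<Longrightarrow> r' \<in> span U \<Longrightarrow> U \<subseteq> monomials \<Longrightarrow> r \<oplus> r' \<in> span U"
proof (induction rule: span.induct)
  case zero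
  then show ?case using span_carrier by (simp add: subset_iff)
next
  case (add k m r)
  then have "r \<in> carrier R" "r' \<in> carrier R" "m \<in> monomials" using span_carrier by blast+
  then have "k \<otimes> monomial R m \<oplus> r \<oplus> r' = k \<otimes> monomial R m \<oplus> (r \<oplus> r')"
    using add.hyps by (simp add: a_assoc)
  then show ?case using add by (simp add: span.add)
qed

lemma span_mult:
  assumes U: "U \<subseteq> monomials" and W: "W \<subseteq> monomials" and Y: "Y \<subseteq> monomials"
    and UW: "\<And>m n. m \<in> U \<Longrightarrow> n \<in> W \<Longrightarrow> m + n \<in> Y"
  shows "r \<in> span U \<Longrightarrow> s \<in> span W \<Longrightarrow> r \<otimes> s \<in> span Y"
proof (induction rule: span.induct)
  case zero
  then have "s \<in> carrier R" using span_carrier[OF W] by blast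
  then show ?case by (simp add: span.zero)
next
  case (add k m r)
  have r: "r \<in> carrier R" and s: "s \<in> carrier R" and m: "m \<in> monomials"
    using add span_carrier[OF U] span_carrier[OF W] U by blast+
  from \<open>s \<in> span W\<close> have "k \<otimes> monomial R m \<otimes> s \<in> span Y"
  proof (induction rule: span.induct)
    case zero
    then show ?case using add.hyps m by (simp add: span.zero)
  next
    case (add l n s)
    have n: "n \<in> monomials" and s: "s \<in> carrier R" using add W span_carrier[OF W] by blast+
    have "k \<otimes> monomial R m \<otimes> (l \<otimes> monomial R n \<oplus> s) =
        (k \<otimes> l) \<otimes> monomial R (m + n) \<oplus> k \<otimes> monomial R m \<otimes> s"
      using \<open>k \<in> K\<close> \<open>l \<in> K\<close> m n s monomial_mult[OF m n] monomial_carrier[OF m] monomial_carrier[OF n]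
      by (simp add: r_distr m_ac del: monomial_carrier)
    moreover have "m + n \<in> Y" using UW \<open>m \<in> U\<close> \<open>n \<in> W\<close> by blast
    ultimately show ?case using \<open>k \<in> K\<close> \<open>l \<in> K\<close> add.IH by (simp add: span.add)
  qed
  moreover have "(k \<otimes> monomial R m \<oplus> r) \<otimes> s = k \<otimes> monomial R m \<otimes> s \<oplus> r \<otimes> s"
    using add.hyps monomial_carrier[OF m] r s by (simp add: l_distr del: monomial_carrier)
  ultimately show ?case using add.IH[OF add.prems] span_add[OF _ _ Y] by simp
qed

text \<open>Every ring element is a combination of monomials, so absorption is an instance of
  \<open>span_mult\<close> with the first factor taken from \<open>span monomials\<close>. Negatives
  are multiples by \<open>\<ominus> \<one>\<close>.\<close>

lemma span_ideal:
  assumes U: "U \<subseteq> monomials" and up: "\<And>m n. m \<in> U \<Longrightarrow> n \<in> monomials \<Longrightarrow> m + n \<in> U"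
  shows "ideal (span U) R"
proof (rule idealI)
  have l: "x \<otimes> r \<in> span U" if "r \<in> span U" "x \<in> carrier R" for x r
  proof (rule span_mult[OF subset_refl U U])
    show "m + n \<in> U" if "m \<in> monomials" "n \<in> U" for m n
      using up[OF that(2,1)] by (simp add: union_commute)
  qed (use that span_monomials in auto)
  show "ring R" by (rule ring_axioms)
  show "subgroup (span U) (add_monoid R)"
  proof (rule add.subgroupI)
    show "span U \<subseteq> carrier R" by (rule span_carrier[OF U])
    show "span U \<noteq> {}" using span.zero by blast
    show "r \<oplus> r' \<in> span U" if "r \<in> span U" "r' \<in> span U" for r r'
      using span_add that U by blast
    show "\<ominus> r \<in> span U" if "r \<in> span U" for r
    proof -
      have "r \<in> carrier R" using that span_carrier[OF U] by blast
      then have "\<ominus> r = \<ominus> \<one> \<otimes> r" by (simp add: l_minus)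
      then show ?thesis using l[OF that, of "\<ominus> \<one>"] by simp
    qed
  qed
  show "x \<otimes> r \<in> span U" "r \<otimes> x \<in> span U" if "r \<in> span U" "x \<in> carrier R" for x r
    using l[OF that] span_carrier[OF U] that m_comm[of x r] by (auto simp: subset_iff)
qed

section \<open>Exponent sets of powers of a monomial ideal\<close>

definition ideal_monomials :: "'a set \<Rightarrow> 'a multiset set" where
  "ideal_monomials I = {m \<in> monomials. monomial R m \<in> I}"

text \<open>The value at \<open>0\<close> is all of \<open>monomials\<close> rather than the empty
  multiset alone, matching the convention that the zeroth power of an ideal is the whole
  ring.\<close>

fun sumset_pow :: "'a multiset set \<Rightarrow> nat \<Rightarrow> 'a multiset set" where
  "sumset_pow U 0 = monomials"
| "sumset_pow U (Suc k) = {a + b | a b. a \<in> sumset_pow U k \<and> b \<in> U}"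

lemma sumset_pow_subset: "U \<subseteq> monomials \<Longrightarrow> sumset_pow U k \<subseteq> monomials"
  by (induction k) fastforce+

context
  fixes I assumes I: "ideal I R" and mono: "monomial_ideal R V I"
begin

lemma ideal_monomials_subset: "ideal_monomials I \<subseteq> monomials"
  by (auto simp: ideal_monomials_def)

lemma ideal_monomials_up:
  assumes "m \<in> ideal_monomials I" "n \<in> monomials"
  shows "m + n \<in> ideal_monomials I"
  using assms monomial_mult[of m n] ideal.I_r_closed[OF I, of "monomial R m" "monomial R n"]
    monomial_carrier[OF assms(2)]
  by (auto simp: ideal_monomials_def)

lemma sumset_pow_up:
  "m \<in> sumset_pow (ideal_monomials I) k \<Longrightarrow> n \<in> monomials \<Longrightarrow>
    m + n \<in> sumset_pow (ideal_monomials I) k"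
proof (cases k)
  case 0
  then show "m \<in> sumset_pow (ideal_monomials I) k \<Longrightarrow> n \<in> monomials \<Longrightarrow> ?thesis" by auto
next
  case (Suc j)
  assume "m \<in> sumset_pow (ideal_monomials I) k" and n: "n \<in> monomials"
  then obtain a b where "m = a + b" "a \<in> sumset_pow (ideal_monomials I) j" "b \<in> ideal_monomials I"
    using Suc by auto
  then have "m + n = a + (b + n)" "b + n \<in> ideal_monomials I"
    using ideal_monomials_up n by (simp_all add: add.assoc)
  then show ?thesis
    using \<open>a \<in> sumset_pow (ideal_monomials I) j\<close> unfolding Suc sumset_pow.simps by blast
qed

text \<open>Split the exponent as \<open>a + b\<close> with \<open>b\<close> the last summand. If
  \<open>x\<close> occurs in \<open>a\<close>, the induction hypothesis removes it there at the cost
  of one summand, and \<open>b\<close> restores the count. If \<open>x\<close> occurs in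
  \<open>b\<close>, what is left of \<open>b\<close> may drop out of the ideal, but \<open>a\<close>
  already has enough summands and absorbs it.\<close>

lemma sumset_pow_cancel_variable:
  assumes "x \<in> V"
  shows "add_mset x m \<in> sumset_pow (ideal_monomials I) (Suc k) \<Longrightarrow>
    m \<in> sumset_pow (ideal_monomials I) k"
proof (induction k arbitrary: m)
  case 0
  then have "add_mset x m \<in> monomials"
    using sumset_pow_subset[OF ideal_monomials_subset, of "Suc 0"] by blast
  then show ?case by simp
next
  case (Suc k)
  then obtain a b where ab: "add_mset x m = a + b"
    "a \<in> sumset_pow (ideal_monomials I) (Suc k)" "b \<in> ideal_monomials I"
    unfolding sumset_pow.simps(2)[of _ "Suc k"] by blast
  have "x \<in># a + b" using ab(1) by (metis union_single_eq_member)
  then consider "x \<in># a" | "x \<in># b" by auto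
  then show ?case
  proof cases
    case 1
    then obtain a' where a': "a = add_mset x a'" by (blast dest: multi_member_split)
    then have "a' \<in> sumset_pow (ideal_monomials I) k" using Suc.IH ab(2) by blast
    moreover have "m = a' + b" using ab(1) a' by simp
    ultimately show ?thesis using ab(3) by auto
  next
    case 2
    then obtain b' where b': "b = add_mset x b'" by (blast dest: multi_member_split)
    then have "b' \<in> monomials" using ab(3) by (simp add: ideal_monomials_def)
    then have "a + b' \<in> sumset_pow (ideal_monomials I) (Suc k)"
      using ab(2) by (intro sumset_pow_up)
    moreover have "m = a + b'" using ab(1) b' by simp
    ultimately show ?thesis by simp
  qed
qed

text \<open>The exponents of monomials in \<open>I\<close> are closed under adding monomials, so
  they span an ideal; it contains the generators and is contained in \<open>I\<close>.\<close>

lemma ideal_eq_span: "I = span (ideal_monomials I)"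
proof
  interpret I: ideal I R by (rule I)
  obtain S where S: "S \<subseteq> {monomial R m | m. m \<in> monomials}" "I = genideal R S"
    using mono by (auto simp: monomial_ideal_def)
  have "S \<subseteq> I"
    unfolding S(2) using S(1) monomial_carrier by (intro genideal_self) blast
  have "S \<subseteq> span (ideal_monomials I)"
  proof
    fix s assume s: "s \<in> S"
    then obtain m where m: "m \<in> monomials" "s = monomial R m" using S(1) by blast
    \<comment> \<open>A single monomial is put into the shape that the introduction rules of
      \<open>span\<close> produce.\<close>
    have "\<one> \<otimes> monomial R m \<oplus> \<zero> \<in> span (ideal_monomials I)"
      using m s \<open>S \<subseteq> I\<close> by (intro span.add span.zero) (auto simp: ideal_monomials_def)
    then show "s \<in> span (ideal_monomials I)" using m monomial_carrier[OF m(1)] by simp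
  qed
  then show "I \<subseteq> span (ideal_monomials I)"
    unfolding S(2)
    by (metis S(2) genideal_minimal ideal_monomials_subset ideal_monomials_up span_ideal)
  show "span (ideal_monomials I) \<subseteq> I"
  proof
    fix r assume "r \<in> span (ideal_monomials I)"
    then show "r \<in> I"
      by induction (auto simp: ideal_monomials_def intro!: I.a_closed I.I_l_closed)
  qed
qed

text \<open>Products of combinations expand into monomials whose exponents add; conversely, a
  monomial with exponent \<open>a + b\<close> is a product of one from the lower power and one from
  \<open>I\<close>.\<close>

lemma ideal_pow_eq_span: "ideal_pow R I k = span (sumset_pow (ideal_monomials I) k)"
proof (induction k)
  case 0
  show ?case by (simp add: span_monomials)
next
  case (Suc k)
  let ?U = "sumset_pow (ideal_monomials I)"
  note sub = sumset_pow_subset[OF ideal_monomials_subset]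
  show ?case
  proof
    show "ideal_pow R I (Suc k) \<subseteq> span (?U (Suc k))"
    proof
      fix r assume "r \<in> ideal_pow R I (Suc k)"
      then have "r \<in> ideal_pow R I k \<cdot> I" by simp
      then show "r \<in> span (?U (Suc k))"
      proof (induction rule: ideal_prod.induct)
        case (prod a b)
        then have "a \<in> span (?U k)" "b \<in> span (ideal_monomials I)"
          using Suc.IH ideal_eq_span by blast+
        then show ?case
          by (rule span_mult[OF sub ideal_monomials_subset sub, rotated]) auto
      next
        case (sum a b)
        then show ?case using span_add sub by blast
      qed
    qed
    show "span (?U (Suc k)) \<subseteq> ideal_pow R I (Suc k)"
    proof
      interpret J: ideal "ideal_pow R I k \<cdot> I" R
        using ideal_pow_ideal[OF I, of "Suc k"] by simp
      fix r assume "r \<in> span (?U (Suc k))"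
      then have "r \<in> ideal_pow R I k \<cdot> I"
      proof induction
        case zero
        show ?case by (rule J.zero_closed)
      next
        case (add c m r)
        then obtain a b where ab: "m = a + b" "a \<in> ?U k" "b \<in> ideal_monomials I" by auto
        have a: "a \<in> monomials" and b: "b \<in> monomials"
          using ab(2,3) sub ideal_monomials_subset by blast+
        have "\<one> \<otimes> monomial R a \<oplus> \<zero> \<in> span (?U k)"
          using ab(2) by (intro span.add span.zero) simp_all
        then have "monomial R a \<in> ideal_pow R I k"
          using Suc.IH monomial_carrier[OF a] by simp
        moreover have "monomial R b \<in> I" using ab(3) by (simp add: ideal_monomials_def)
        ultimately have "monomial R m \<in> ideal_pow R I k \<cdot> I"
          unfolding ab(1) monomial_mult[OF a b] by (rule ideal_prod.prod)
        then show ?case using add by (intro J.a_closed J.I_l_closed) auto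
      qed
      then show "r \<in> ideal_pow R I (Suc k)" by simp
    qed
  qed
qed

lemma ideal_pow_cancel_variable:
  assumes x: "x \<in> V" and g: "g \<in> carrier R" and xg: "x \<otimes> g \<in> ideal_pow R I (Suc k)"
  shows "g \<in> ideal_pow R I k"
proof -
  note sub = sumset_pow_subset[OF ideal_monomials_subset]
  obtain c where c: "c \<in> indexed_pset V K" "g = peval c"
    using g bij_betw_imp_surj_on[OF bij_peval] by blast
  obtain d where d: "d \<in> indexed_pset V K" "x \<otimes> g = peval d"
      "{m. d m \<noteq> \<zero>} \<subseteq> sumset_pow (ideal_monomials I) (Suc k)"
    using xg unfolding ideal_pow_eq_span by (rule spanE[OF _ sub])
  \<comment> \<open>Uniqueness of coefficients: the shifted coefficients of \<open>g\<close> are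
    those of \<open>x \<otimes> g\<close>, so every exponent \<open>m\<close> of \<open>g\<close>
    has \<open>add_mset x m\<close> in the exponent set of the power.\<close>
  have "indexed_pmult c x = d"
    using bij_betw_imp_inj_on[OF bij_peval] indexed_pset.indexed_pmult[OF c(1) x] d(1)
      peval_pmult[OF c(1) x] c(2) d(2) by (metis inj_onD)
  then have "add_mset x m \<in> sumset_pow (ideal_monomials I) (Suc k)" if "c m \<noteq> \<zero>" for m
    using d(3) that by (auto simp: indexed_pmult_def simp del: sumset_pow.simps)
  then have "{m. c m \<noteq> \<zero>} \<subseteq> sumset_pow (ideal_monomials I) k"
    using sumset_pow_cancel_variable[OF x] by blast
  then show ?thesis
    unfolding ideal_pow_eq_span c(2) by (rule peval_mem_span[OF c(1)])
qed

end

end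

section \<open>Symbolic powers and v-numbers\<close>

lemma (in primeideal) local_ext_eq_ext:
  assumes "ideal J R"
  shows "local_ext R I J = cring_localization.ext R (carrier R - I) J"
proof -
  interpret L: cring_localization R "carrier R - I" by (rule localization_at)
  show ?thesis
    using L.genideal_eq_ext[OF assms] by (simp add: local_ext_def local_ring_at_def local_map_def)
qed

lemma (in primeideal) local_map_mem_local_ext_iff:
  assumes "ideal J R" "r \<in> carrier R"
  shows "local_map R I r \<in> local_ext R I J \<longleftrightarrow> (\<exists>s\<in>carrier R - I. s \<otimes> r \<in> J)"
proof -
  interpret L: cring_localization R "carrier R - I" by (rule localization_at)
  show ?thesis
    using L.fraction_mem_ext_iff[OF assms, of \<one>] L.S.one_closed
    by (simp add: local_ext_eq_ext[OF assms(1)] local_map_def)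
qed

lemma minimal_primes_prime: "P \<in> minimal_primes R I \<Longrightarrow> primeideal P R"
  by (simp add: minimal_primes_def)

context cring
begin

text \<open>Localization is eliminated here: membership is certified by one multiplier outside each
  associated prime, and the passage from \<open>t + 1\<close> to \<open>t\<close> becomes a matter
  of finding such multipliers.\<close>

lemma mem_symbolic_power_iff:
  assumes "ideal I R"
  shows "r \<in> symbolic_power R I t \<longleftrightarrow> r \<in> carrier R \<and>
    (\<forall>P\<in>assoc_primes R (quotient_module R I). \<exists>s\<in>carrier R - P. s \<otimes> r \<in> ideal_pow R I t)"
proof -
  have "primeideal P R" if "P \<in> assoc_primes R (quotient_module R I)" for P
    using that by (simp add: assoc_primes_def)
  then show ?thesis
    using primeideal.local_map_mem_local_ext_iff[OF _ ideal_pow_ideal[OF assms]]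
    unfolding symbolic_power_def by blast
qed

text \<open>After clearing denominators, \<open>Pf\<close> says that the maximal ideal of the local
  ring multiplies \<open>f/1\<close> into the power \<open>t + 1\<close> of the extended ideal, so
  the depth argument applies there.\<close>

lemma local_mem_of_depth_gr_pos:
  assumes P: "primeideal P R" and I: "ideal I R" "I \<subseteq> P"
    and depth: "depth_gr_local R I P \<ge> 1"
    and f: "f \<in> carrier R"
    and Pf: "\<And>p. p \<in> P \<Longrightarrow> \<exists>s\<in>carrier R - P. s \<otimes> (p \<otimes> f) \<in> ideal_pow R I (Suc t)"
  shows "\<exists>s\<in>carrier R - P. s \<otimes> f \<in> ideal_pow R I t"
proof -
  interpret P: primeideal P R by (rule P)
  interpret L: cring_localization R "carrier R - P" by (rule P.localization_at)
  note powI = ideal_pow_ideal[OF I(1)]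
  have "fraction R (carrier R - P) f \<one> \<in> ideal_pow (localization R (carrier R - P)) (L.ext I) t"
  proof (rule L.L.mem_ideal_pow_of_depth_gr_pos[where m = "L.ext P"])
    show "ideal (L.ext I) (localization R (carrier R - P))" by (rule L.ext_ideal[OF I(1)])
    show "L.ext I \<subseteq> L.ext P" using I(2) by (auto simp: L.ext_def)
    show "L.ext P \<subseteq> carrier (localization R (carrier R - P))"
      by (rule ideal.Icarr[OF L.ext_ideal[OF P.is_ideal], THEN subsetI])
    show "1 \<le> depth (assoc_graded_ring (localization R (carrier R - P)) (L.ext I))
        (assoc_graded_max_ideal (localization R (carrier R - P)) (L.ext I) (L.ext P))"
      using depth by (simp add: depth_gr_local_def local_ring_at_def
          P.local_ext_eq_ext[OF I(1)] P.local_ext_eq_ext[OF P.is_ideal])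
    show "fraction R (carrier R - P) f \<one> \<in> carrier (localization R (carrier R - P))"
      using f L.S.one_closed by (rule L.fraction_closed)
    fix y assume "y \<in> L.ext P"
    then obtain p s where y: "y = fraction R (carrier R - P) p s" "p \<in> P" "s \<in> carrier R - P"
      by (auto simp: L.ext_def)
    have "y \<otimes>\<^bsub>localization R (carrier R - P)\<^esub> fraction R (carrier R - P) f \<one> =
        fraction R (carrier R - P) (p \<otimes> f) (s \<otimes> \<one>)"
      unfolding y(1) by (rule L.fraction_mult) (use y f L.S.one_closed P.Icarr in auto)
    also have "\<dots> \<in> L.ext (ideal_pow R I (Suc t))"
      using Pf[OF y(2)] y f P.Icarr by (subst L.fraction_mem_ext_iff[OF powI]) auto
    finally show "y \<otimes>\<^bsub>localization R (carrier R - P)\<^esub> fraction R (carrier R - P) f \<one>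
        \<in> ideal_pow (localization R (carrier R - P)) (L.ext I) (Suc t)"
      by (simp only: L.ext_ideal_pow[OF I(1)])
  qed
  then show ?thesis
    unfolding L.ext_ideal_pow[OF I(1), symmetric]
    using L.fraction_mem_ext_iff[OF powI f L.S.one_closed] by blast
qed

text \<open>As \<open>I\<close> is not zero, it has a monomial generator. This lies in the prime
  \<open>P\<close>, so one of its variables does.\<close>

lemma monomial_ideal_variable_mem:
  assumes "V \<subseteq> carrier R" "monomial_ideal R V I" "I \<noteq> {\<zero>}" "primeideal P R" "I \<subseteq> P"
  obtains x where "x \<in> V" "x \<in> P"
proof -
  obtain S where S: "S \<subseteq> {monomial R m | m. set_mset m \<subseteq> V}" "I = genideal R S"
    using assms(2) by (auto simp: monomial_ideal_def)
  have "S \<subseteq> carrier R" using S(1) assms(1) by (fast intro: monomial_closed)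
  then have "S \<subseteq> I" "ideal I R" unfolding S(2) by (rule genideal_self, rule genideal_ideal)
  moreover have "S \<noteq> {}"
  proof
    assume "S = {}"
    then have "I \<subseteq> {\<zero>}" unfolding S(2) by (intro genideal_minimal zeroideal) simp
    then show False
      using assms(3) additive_subgroup.zero_closed[OF ideal.axioms(1)[OF \<open>ideal I R\<close>]] by blast
  qed
  ultimately obtain m where m: "set_mset m \<subseteq> V" "monomial R m \<in> P" using S(1) assms(5) by blast
  show thesis
    by (rule primeideal.variable_mem_of_monomial_mem[OF assms(4) m(2)]) (use m assms(1) that in auto)
qed

text \<open>A single variable \<open>x\<close> in \<open>P\<close> suffices. Its multiplier
  \<open>s\<close> commutes past \<open>x\<close>, so the cancellation takes place in
  \<open>R\<close>, applied to \<open>s \<otimes> f\<close>, and the same \<open>s\<close> serves as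
  witness.\<close>

lemma local_mem_of_monomial:
  assumes P: "primeideal P R" and I: "ideal I R" "I \<subseteq> P" "I \<noteq> {\<zero>}"
    and K: "subring K R" and poly: "is_polynomial_ring R K V" and mono: "monomial_ideal R V I"
    and f: "f \<in> carrier R"
    and Pf: "\<And>p. p \<in> P \<Longrightarrow> \<exists>s\<in>carrier R - P. s \<otimes> (p \<otimes> f) \<in> ideal_pow R I (Suc t)"
  shows "\<exists>s\<in>carrier R - P. s \<otimes> f \<in> ideal_pow R I t"
proof -
  interpret polynomial_ring_in R K V
    by (intro polynomial_ring_in.intro polynomial_ring_in_axioms.intro cring_axioms K poly)
  obtain x where x: "x \<in> V" "x \<in> P"
    using monomial_ideal_variable_mem[OF V_subset mono I(3) P I(2)] .
  obtain s where s: "s \<in> carrier R - P" "s \<otimes> (x \<otimes> f) \<in> ideal_pow R I (Suc t)"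
    using Pf[OF x(2)] by blast
  have "x \<in> carrier R" using x(1) V_subset by blast
  then have "x \<otimes> (s \<otimes> f) \<in> ideal_pow R I (Suc t)" using s f by (simp add: m_lcomm)
  then have "s \<otimes> f \<in> ideal_pow R I t"
    by (rule ideal_pow_cancel_variable[OF I(1) mono x(1), rotated]) (use s(1) f in simp)
  then show ?thesis using s(1) by blast
qed

text \<open>The premise \<open>local\<close> isolates what must be known at \<open>P\<close> itself,
  so that the depth condition and the monomial condition enter in the same way. The other minimal
  primes are treated uniformly.\<close>

lemma mem_symbolic_power_of_colon:
  assumes I: "ideal I R" and ass: "assoc_primes R (quotient_module R I) = minimal_primes R I"
    and P: "P \<in> minimal_primes R I" and f: "f \<in> carrier R"
    and local: "(\<And>p. p \<in> P \<Longrightarrow> \<exists>s\<in>carrier R - P. s \<otimes> (p \<otimes> f) \<in> ideal_pow R I (Suc t)) \<Longrightarrow>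
      \<exists>s\<in>carrier R - P. s \<otimes> f \<in> ideal_pow R I t"
    and Pf: "\<And>p. p \<in> P \<Longrightarrow> p \<otimes> f \<in> symbolic_power R I (Suc t)"
  shows "f \<in> symbolic_power R I t"
proof -
  have colon: "\<exists>s\<in>carrier R - Q. s \<otimes> (p \<otimes> f) \<in> ideal_pow R I (Suc t)"
    if "p \<in> P" "Q \<in> minimal_primes R I" for p Q
    using Pf[OF that(1)] that(2) ass unfolding mem_symbolic_power_iff[OF I] by blast
  have "\<exists>s\<in>carrier R - Q. s \<otimes> f \<in> ideal_pow R I t" if Q: "Q \<in> minimal_primes R I" for Q
  proof (cases "Q = P")
    case True
    then show ?thesis using local colon[OF _ P] by blast
  next
    case False
    interpret Q: primeideal Q R by (rule minimal_primes_prime[OF Q])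
    interpret P: primeideal P R by (rule minimal_primes_prime[OF P])
    \<comment> \<open>Distinct minimal primes are incomparable. An element \<open>p\<close> of
      \<open>P\<close> outside \<open>Q\<close> can then be moved into the multiplier, where
      \<open>s \<otimes> p\<close> avoids \<open>Q\<close> by primality.\<close>
    have "\<not> P \<subseteq> Q" using False P Q by (auto simp: minimal_primes_def)
    then obtain p where p: "p \<in> P" "p \<notin> Q" by blast
    obtain s where s: "s \<in> carrier R - Q" "s \<otimes> (p \<otimes> f) \<in> ideal_pow R I (Suc t)"
      using colon[OF p(1) Q] by blast
    have "(s \<otimes> p) \<otimes> f \<in> ideal_pow R I t"
      using s p f P.Icarr ideal_pow_Suc_subset[OF I, of t] by (auto simp: m_assoc)
    moreover have "s \<otimes> p \<in> carrier R - Q" using s p P.Icarr Q.I_prime by blast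
    ultimately show ?thesis by blast
  qed
  then show ?thesis unfolding mem_symbolic_power_iff[OF I] ass using f by blast
qed

section \<open>Annihilators and v-numbers of subquotients\<close>

text \<open>Because \<open>\<zero> \<in> L\<close>, each element lies in its own coset. The scalar
  product is a union over representatives, hence contains \<open>r \<otimes> x\<close>, and the
  annihilator condition says that this union is \<open>L\<close>.\<close>

lemma mult_mem_of_mem_annihilator:
  assumes "\<zero> \<in> L" "x \<in> carrier R" "r \<in> annihilator R (subquotient R K L) (L +> x)"
  shows "r \<otimes> x \<in> L"
proof -
  have r: "r \<in> carrier R" and eq: "rcoset_mult R L (L +> r) (L +> x) = L"
    using assms(3) by (simp_all add: annihilator_def subquotient_def)
  have self: "a \<in> L +> a" if "a \<in> carrier R" for a
    unfolding a_r_coset_def' using assms(1) that by force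
  have "r \<otimes> x \<in> rcoset_mult R L (L +> r) (L +> x)"
    unfolding rcoset_mult_def using self r assms(2) by (meson UN_I m_closed)
  then show ?thesis using eq by simp
qed

end

text \<open>The scalar multiplication and the zero depend on \<open>L\<close> alone. Replacing
  \<open>K\<close> changes which elements compete for the minimum, but not their
  annihilators.\<close>

lemma annihilator_subquotient:
  "annihilator R (subquotient R K L) m = annihilator R (subquotient R K' L) m"
  by (simp add: annihilator_def subquotient_def)

text \<open>By \<open>colon\<close>, any representative of a class in the quotient by
  \<open>L\<close> with annihilator \<open>P\<close> already lies in \<open>K\<close>. The same
  degrees occur on both sides, so the infima agree, also when both are
  \<open>\<infinity>\<close>.\<close>

lemma (in cring) v_subquotient_eq_v_ideal:
  assumes "\<zero> \<in> L" "K \<subseteq> carrier R"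
    and colon: "\<And>x. x \<in> carrier R \<Longrightarrow> (\<And>p. p \<in> P \<Longrightarrow> p \<otimes> x \<in> L) \<Longrightarrow> x \<in> K"
  shows "v_subquotient R G K L P = v_ideal R G L P"
proof -
  have "x \<in> K"
    if "x \<in> carrier R" "annihilator R (quotient_module R L) (L +> x) = P" for x
    using colon[OF that(1)] mult_mem_of_mem_annihilator[OF assms(1) that(1)] that(2) by blast
  then have "(\<exists>m\<in>subquotient_component R G K L d. annihilator R (subquotient R K L) m = P) \<longleftrightarrow>
      (\<exists>m\<in>subquotient_component R G (carrier R) L d. annihilator R (quotient_module R L) m = P)"
    for d
    using assms(2) unfolding subquotient_component_def annihilator_subquotient[of R K L _ "carrier R"]
    by blast
  then show ?thesis by (simp add: v_ideal_def v_subquotient_def local_v_number_def)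
qed

theorem theorem3p2:
  fixes R :: "('a, 'm) ring_scheme" and G :: "nat \<Rightarrow> 'a set" and I P :: "'a set" and t :: nat
  assumes "standard_graded_ring R G"
    and "noetherian_ring R"
    and "subfield (G 0) R"
    and "graded_ideal R G I"
    and "I \<noteq> {\<zero>\<^bsub>R\<^esub>}"
    and "I \<noteq> carrier R"
    and "assoc_primes R (quotient_module R I) = minimal_primes R I"
    and "ideal_height R I \<ge> 1"
    and "t \<ge> 1"
    and "P \<in> minimal_primes R I"
    and "depth_gr_local R I P \<ge> 1 \<or>
         (\<exists>V. finite V \<and> V \<subseteq> G 1 \<and> is_polynomial_ring R (G 0) V \<and> monomial_ideal R V I)"
  shows "v_subquotient R G (symbolic_power R I t) (symbolic_power R I (t + 1)) P =
         v_ideal R G (symbolic_power R I (t + 1)) P"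
proof -
  interpret standard_graded_ring R G by fact
  have I: "ideal I R" using assms(4) by (simp add: graded_ideal_def)
  have P: "primeideal P R" "I \<subseteq> P" using assms(10) by (simp_all add: minimal_primes_def)
  have local: "\<exists>s\<in>carrier R - P. s \<otimes>\<^bsub>R\<^esub> f \<in> ideal_pow R I t"
    if "f \<in> carrier R"
      "\<And>p. p \<in> P \<Longrightarrow> \<exists>s\<in>carrier R - P. s \<otimes>\<^bsub>R\<^esub> (p \<otimes>\<^bsub>R\<^esub> f) \<in> ideal_pow R I (Suc t)" for f
    using assms(11)
  proof
    assume "depth_gr_local R I P \<ge> 1"
    then show ?thesis by (rule local_mem_of_depth_gr_pos[OF P(1) I P(2) _ that])
  next
    assume "\<exists>V. finite V \<and> V \<subseteq> G 1 \<and> is_polynomial_ring R (G 0) V \<and> monomial_ideal R V I"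
    then show ?thesis
      using local_mem_of_monomial[OF P(1) I P(2) assms(5) subfieldE(1)[OF assms(3)] _ _ that] by blast
  qed
  have "\<zero>\<^bsub>R\<^esub> \<in> symbolic_power R I (t + 1)"
  proof -
    have "\<zero>\<^bsub>R\<^esub> \<in> ideal_pow R I (t + 1)"
      by (rule additive_subgroup.zero_closed[OF ideal.axioms(1)[OF ideal_pow_ideal[OF I]]])
    \<comment> \<open>The multiplier for zero can be \<open>\<one>\<close> at every prime.\<close>
    moreover have "\<one>\<^bsub>R\<^esub> \<in> carrier R - Q" if "primeideal Q R" for Q
      using primeideal.I_notcarr[OF that] ideal.one_imp_carrier[OF primeideal.axioms(1)[OF that]] by auto
    ultimately show ?thesis
      by (auto simp: mem_symbolic_power_iff[OF I] assoc_primes_def)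
  qed
  moreover have "symbolic_power R I t \<subseteq> carrier R" by (auto simp: symbolic_power_def)
  \<comment> \<open>This is the premise \<open>colon\<close> of
    \<open>v_subquotient_eq_v_ideal\<close>, with the \<open>t\<close>-th symbolic power as
    \<open>K\<close> and the next one as \<open>L\<close>.\<close>
  moreover have "f \<in> symbolic_power R I t"
    if "f \<in> carrier R" "\<And>p. p \<in> P \<Longrightarrow> p \<otimes>\<^bsub>R\<^esub> f \<in> symbolic_power R I (t + 1)" for f
    by (rule mem_symbolic_power_of_colon[OF I assms(7,10) that(1) local[OF that(1)]])
      (use that(2) in simp_all)
  ultimately show ?thesis by (rule v_subquotient_eq_v_ideal)
qed

end
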